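(* Let $\phi:\mathcal{H}\to\mathbb{C}$ be a nonzero Lie algebra homomorphism. For any $\xi\in\mathbb{C}$, $W_{\phi,\xi}$ is a maximal submodule of $M_\phi$, and hence $L_{\phi,\xi}$ is simple.
   Context: The Schrödinger algebra $\mathfrak{S}$ is the complex Lie algebra with basis $e,h,f,p,q,z$ and brackets $[h,e]=2e$, $[h,f]=-2f$, $[e,f]=h$, $[h,p]=p$, $[h,q]=-q$, $[p,q]=z$, $[e,q]=p$, $[p,f]=-q$, $[f,q]=0$, $[e,p]=0$, $[z,\mathfrak{S}]=0$. Its Heisenberg subalgebra is $\mathcal{H}=\mathrm{span}_{\mathbb{C}}\{p,q,z\}$; every Lie algebra homomorphism $\phi:\mathcal{H}\to\mathbb{C}$ satisfies $\phi(z)=0$. For $\phi\neq 0$, the universal quasi-Whittaker module of type $\phi$ is $M_\phi=\mathcal{U}(\mathfrak{S})\otimes_{\mathcal{U}(\mathcal{H})}\mathbb{C}_\phi$, where $\mathbb{C}_\phi=\mathbb{C}w$ is the one-dimensional $\mathcal{H}$-module with $xw=\phi(x)w$ for $x\in\mathcal{H}$; write $w$ also for its cyclic vector $1\otimes w$. Put $C=\phi(p)^2f-\phi(q)^2e-\phi(p)\phi(q)h\in\mathcal{U}(\mathfrak{S})$. For $\xi\in\mathbb{C}$ put $W_{\phi,\xi}=\mathcal{U}(\mathfrak{S})(C-\xi)w\subseteq M_\phi$ and $L_{\phi,\xi}=M_\phi/W_{\phi,\xi}$. *)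

theory Defs
  imports
    "HOL-Analysis.Cartesian_Space"
    "HOL-Algebra.Free_Abelian_Groups"
    "HOL-Algebra.QuotRing"
    "HOL-Algebra.Module"
begin

section \<open>The Schroedinger algebra\<close>

datatype sbasis = BE | BH | BF | BP | BQ | BZ

lemma UNIV_sbasis: "UNIV = {BE, BH, BF, BP, BQ, BZ}"
  by (auto intro: sbasis.exhaust)

instance sbasis :: finite
  by standard (simp add: UNIV_sbasis)

type_synonym schrodinger = "complex ^ sbasis"

definition sch_e :: schrodinger where "sch_e = axis BE 1"
definition sch_h :: schrodinger where "sch_h = axis BH 1"
definition sch_f :: schrodinger where "sch_f = axis BF 1"
definition sch_p :: schrodinger where "sch_p = axis BP 1"
definition sch_q :: schrodinger where "sch_q = axis BQ 1"
definition sch_z :: schrodinger where "sch_z = axis BZ 1"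

text \<open>Each unordered pair of basis vectors with nonzero bracket is listed in one order only;
  \<open>sch_bracket\<close> antisymmetrises the table and extends it bilinearly.\<close>

fun sch_table :: "sbasis \<Rightarrow> sbasis \<Rightarrow> schrodinger" where
  "sch_table BH BE = 2 *s sch_e"
| "sch_table BH BF = (-2) *s sch_f"
| "sch_table BE BF = sch_h"
| "sch_table BH BP = sch_p"
| "sch_table BH BQ = - sch_q"
| "sch_table BP BQ = sch_z"
| "sch_table BE BQ = sch_p"
| "sch_table BP BF = - sch_q"
| "sch_table _ _ = 0"

definition sch_bracket :: "schrodinger \<Rightarrow> schrodinger \<Rightarrow> schrodinger" where
  "sch_bracket x y =
    (\<Sum>i\<in>UNIV. \<Sum>j\<in>UNIV. (x $ i * y $ j) *s (sch_table i j - sch_table j i))"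

definition heisenberg :: "schrodinger set" where
  "heisenberg = vec.span {sch_p, sch_q, sch_z}"

lemmas sch_basis_defs = sch_e_def sch_h_def sch_f_def sch_p_def sch_q_def sch_z_def

lemma sch_bracket_table:
  "sch_bracket sch_h sch_e = 2 *s sch_e"
  "sch_bracket sch_h sch_f = (-2) *s sch_f"
  "sch_bracket sch_e sch_f = sch_h"
  "sch_bracket sch_h sch_p = sch_p"
  "sch_bracket sch_h sch_q = - sch_q"
  "sch_bracket sch_p sch_q = sch_z"
  "sch_bracket sch_e sch_q = sch_p"
  "sch_bracket sch_p sch_f = - sch_q"
  "sch_bracket sch_f sch_q = 0"
  "sch_bracket sch_e sch_p = 0"
  "sch_bracket sch_z x = 0"
  by (simp_all add: sch_bracket_def UNIV_sbasis sch_basis_defs axis_def vec_eq_iff)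

lemma all_sbasis:
  "(\<forall>i. P i) \<longleftrightarrow> P BE \<and> P BH \<and> P BF \<and> P BP \<and> P BQ \<and> P BZ"
  by (metis sbasis.exhaust)

lemma sch_bracket_nth:
  "sch_bracket x y $ BE = 2 * (x $ BH * y $ BE - x $ BE * y $ BH)"
  "sch_bracket x y $ BH = x $ BE * y $ BF - x $ BF * y $ BE"
  "sch_bracket x y $ BF = -2 * (x $ BH * y $ BF - x $ BF * y $ BH)"
  "sch_bracket x y $ BP = x $ BH * y $ BP - x $ BP * y $ BH + x $ BE * y $ BQ - x $ BQ * y $ BE"
  "sch_bracket x y $ BQ = - (x $ BH * y $ BQ - x $ BQ * y $ BH) - (x $ BP * y $ BF - x $ BF * y $ BP)"
  "sch_bracket x y $ BZ = x $ BP * y $ BQ - x $ BQ * y $ BP"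
  by (simp_all add: sch_bracket_def UNIV_sbasis sch_basis_defs axis_def algebra_simps)

lemma sch_bracket_self: "sch_bracket x x = 0"
  by (simp add: vec_eq_iff all_sbasis sch_bracket_nth)

lemma sch_jacobi:
  "sch_bracket x (sch_bracket y w) + sch_bracket y (sch_bracket w x)
     + sch_bracket w (sch_bracket x y) = 0"
  by (simp add: vec_eq_iff all_sbasis sch_bracket_nth algebra_simps)

lemma heisenberg_bracket_closed:
  assumes "x \<in> heisenberg" "y \<in> heisenberg"
  shows "sch_bracket x y \<in> heisenberg"
proof -
  have sub: "vec.subspace {v :: schrodinger. v $ BE = 0 \<and> v $ BH = 0 \<and> v $ BF = 0}"
    by (auto simp: vec.subspace_def)
  have "heisenberg \<subseteq> {v. v $ BE = 0 \<and> v $ BH = 0 \<and> v $ BF = 0}"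
    unfolding heisenberg_def
    by (rule vec.span_minimal[OF _ sub]) (auto simp: sch_basis_defs axis_def)
  with assms have "x $ BE = 0 \<and> x $ BH = 0 \<and> x $ BF = 0" "y $ BE = 0 \<and> y $ BH = 0 \<and> y $ BF = 0"
    by auto
  then have "sch_bracket x y = (x $ BP * y $ BQ - x $ BQ * y $ BP) *s sch_z"
    by (simp add: vec_eq_iff all_sbasis sch_bracket_nth) (simp add: sch_z_def axis_def)
  then show ?thesis
    by (simp add: heisenberg_def vec.span_scale vec.span_base)
qed

text \<open>A Lie algebra homomorphism to the complex numbers, whose own bracket is zero.\<close>

definition lie_character :: "schrodinger set \<Rightarrow> (schrodinger \<Rightarrow> complex) \<Rightarrow> bool" where
  "lie_character L \<phi> \<longleftrightarrow>
     (\<forall>x\<in>L. \<forall>y\<in>L. \<phi> (x + y) = \<phi> x + \<phi> y) \<and>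
     (\<forall>c. \<forall>x\<in>L. \<phi> (c *s x) = c * \<phi> x) \<and>
     (\<forall>x\<in>L. \<forall>y\<in>L. \<phi> (sch_bracket x y) = 0)"


section \<open>Universal enveloping algebras\<close>

datatype 'a free_monoid = Word (letters: "'a list")

instantiation free_monoid :: (type) monoid_add
begin

definition zero_free_monoid :: "'a free_monoid" where
  "zero_free_monoid = Word []"

definition plus_free_monoid :: "'a free_monoid \<Rightarrow> 'a free_monoid \<Rightarrow> 'a free_monoid" where
  "plus_free_monoid u v = Word (letters u @ letters v)"

instance
  by standard (simp_all add: zero_free_monoid_def plus_free_monoid_def)

end

text \<open>Since the monoid above is written additively, multiplication of finitely supported
  functions is convolution along concatenation, so these are noncommutative polynomials.
  The elements of \<open>L\<close> themselves (not only those of a basis) are the free variables; the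
  linear relations between them are imposed in \<open>uea_relations\<close>, together with the relations
  coming from the bracket.\<close>

type_synonym 'a free_alg = "'a free_monoid \<Rightarrow>\<^sub>0 complex"

definition fa_var :: "'a \<Rightarrow> 'a free_alg" where
  "fa_var x = Poly_Mapping.single (Word [x]) 1"

definition fa_const :: "complex \<Rightarrow> 'a free_alg" where
  "fa_const c = Poly_Mapping.single 0 c"

definition free_algebra :: "'a set \<Rightarrow> 'a free_alg ring" where
  "free_algebra L =
    \<lparr>carrier = {a. \<forall>w\<in>Poly_Mapping.keys a. set (letters w) \<subseteq> L},
     mult = (*), one = 1, zero = 0, add = (+)\<rparr>"

definition uea_relations :: "schrodinger set \<Rightarrow> schrodinger free_alg set" where
  "uea_relations L =
     {fa_var (x + y) - (fa_var x + fa_var y) |x y. x \<in> L \<and> y \<in> L} \<union>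
     {fa_var (c *s x) - fa_const c * fa_var x |c x. x \<in> L} \<union>
     {fa_var x * fa_var y - fa_var y * fa_var x - fa_var (sch_bracket x y) |x y. x \<in> L \<and> y \<in> L}"

definition uea_ideal :: "schrodinger set \<Rightarrow> schrodinger free_alg set" where
  "uea_ideal L = Idl\<^bsub>free_algebra L\<^esub> (uea_relations L)"

definition uea :: "schrodinger set \<Rightarrow> schrodinger free_alg set ring" where
  "uea L = free_algebra L Quot uea_ideal L"

definition uea_incl :: "schrodinger set \<Rightarrow> schrodinger \<Rightarrow> schrodinger free_alg set" where
  "uea_incl L x = uea_ideal L +>\<^bsub>free_algebra L\<^esub> fa_var x"

definition uea_scalar :: "schrodinger set \<Rightarrow> complex \<Rightarrow> schrodinger free_alg set" where
  "uea_scalar L c = uea_ideal L +>\<^bsub>free_algebra L\<^esub> fa_const c"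

text \<open>The algebra homomorphism from the enveloping algebra of a subalgebra of \<open>L\<close> to the one
  of \<open>L\<close> induced by the inclusion; it sends the class of a noncommutative polynomial to the
  class of the same polynomial. The union is over identical sets.\<close>

definition uea_map :: "schrodinger set \<Rightarrow> schrodinger free_alg set \<Rightarrow> schrodinger free_alg set" where
  "uea_map L X = (\<Union>x\<in>X. uea_ideal L +>\<^bsub>free_algebra L\<^esub> x)"


section \<open>Modules over noncommutative rings\<close>

text \<open>The locale \<open>module\<close> of HOL-Algebra assumes a commutative ring of scalars. The record type
  \<open>module\<close> and the locale \<open>submodule\<close> do not, and are reused. The multiplicative
  part of the record is irrelevant and left undefined below.\<close>

locale left_module = R?: ring R + M?: abelian_group M
  for R :: "('a, 'b) ring_scheme" (structure) and M :: "('a, 'm, 'c) module_scheme" (structure) +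
  assumes smult_closed [simp, intro]:
      "\<lbrakk>a \<in> carrier R; x \<in> carrier M\<rbrakk> \<Longrightarrow> a \<odot>\<^bsub>M\<^esub> x \<in> carrier M"
    and smult_l_distr:
      "\<lbrakk>a \<in> carrier R; b \<in> carrier R; x \<in> carrier M\<rbrakk>
        \<Longrightarrow> (a \<oplus>\<^bsub>R\<^esub> b) \<odot>\<^bsub>M\<^esub> x = a \<odot>\<^bsub>M\<^esub> x \<oplus>\<^bsub>M\<^esub> b \<odot>\<^bsub>M\<^esub> x"
    and smult_r_distr:
      "\<lbrakk>a \<in> carrier R; x \<in> carrier M; y \<in> carrier M\<rbrakk>
        \<Longrightarrow> a \<odot>\<^bsub>M\<^esub> (x \<oplus>\<^bsub>M\<^esub> y) = a \<odot>\<^bsub>M\<^esub> x \<oplus>\<^bsub>M\<^esub> a \<odot>\<^bsub>M\<^esub> y"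
    and smult_assoc:
      "\<lbrakk>a \<in> carrier R; b \<in> carrier R; x \<in> carrier M\<rbrakk>
        \<Longrightarrow> (a \<otimes>\<^bsub>R\<^esub> b) \<odot>\<^bsub>M\<^esub> x = a \<odot>\<^bsub>M\<^esub> (b \<odot>\<^bsub>M\<^esub> x)"
    and smult_one [simp]:
      "x \<in> carrier M \<Longrightarrow> \<one>\<^bsub>R\<^esub> \<odot>\<^bsub>M\<^esub> x = x"

definition maximal_submodule ::
    "'m set \<Rightarrow> ('a, 'b) ring_scheme \<Rightarrow> ('a, 'm, 'c) module_scheme \<Rightarrow> bool" where
  "maximal_submodule N R M \<longleftrightarrow>
     left_module R M \<and> submodule N R M \<and> N \<noteq> carrier M \<and>
     (\<forall>N'. submodule N' R M \<and> N \<subseteq> N' \<longrightarrow> N' = N \<or> N' = carrier M)"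

definition simple_module ::
    "('a, 'b) ring_scheme \<Rightarrow> ('a, 'm, 'c) module_scheme \<Rightarrow> bool" where
  "simple_module R M \<longleftrightarrow>
     left_module R M \<and> carrier M \<noteq> {\<zero>\<^bsub>M\<^esub>} \<and>
     (\<forall>N. submodule N R M \<longrightarrow> N = {\<zero>\<^bsub>M\<^esub>} \<or> N = carrier M)"

definition cyclic_submodule ::
    "('a, 'b) ring_scheme \<Rightarrow> ('a, 'm, 'c) module_scheme \<Rightarrow> 'm \<Rightarrow> 'm set" where
  "cyclic_submodule R M v = {r \<odot>\<^bsub>M\<^esub> v |r. r \<in> carrier R}"

definition quotient_module ::
    "('a, 'm, 'c) module_scheme \<Rightarrow> 'm set \<Rightarrow> ('a, 'm set) module" where
  "quotient_module M N =
    \<lparr>carrier = a_rcosets\<^bsub>M\<^esub> N, mult = undefined, one = undefined, zero = N, add = set_add M,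
     smult = (\<lambda>r X. \<Union>x\<in>X. N +>\<^bsub>M\<^esub> (r \<odot>\<^bsub>M\<^esub> x))\<rparr>"

text \<open>For a ring homomorphism \<open>j\<close> from \<open>A\<close> to \<open>R\<close> and a left \<open>A\<close>-module \<open>N\<close>, the
  tensor product over \<open>A\<close> of \<open>R\<close> (a right \<open>A\<close>-module through \<open>j\<close>) and \<open>N\<close>: the free
  abelian group on pairs modulo the biadditivity and balancing relations. Here \<open>frag_of\<close> is
  the generator of the free abelian group belonging to a pair.\<close>

definition tensor_relations ::
    "('r, 'b) ring_scheme \<Rightarrow> ('a, 'c) ring_scheme \<Rightarrow> ('a \<Rightarrow> 'r) \<Rightarrow> ('a, 'n, 'd) module_scheme
      \<Rightarrow> ('r \<times> 'n \<Rightarrow>\<^sub>0 int) set" where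
  "tensor_relations R A j N =
     {frag_of (u \<oplus>\<^bsub>R\<^esub> v, n) - (frag_of (u, n) + frag_of (v, n)) |u v n.
        u \<in> carrier R \<and> v \<in> carrier R \<and> n \<in> carrier N} \<union>
     {frag_of (u, m \<oplus>\<^bsub>N\<^esub> n) - (frag_of (u, m) + frag_of (u, n)) |u m n.
        u \<in> carrier R \<and> m \<in> carrier N \<and> n \<in> carrier N} \<union>
     {frag_of (u \<otimes>\<^bsub>R\<^esub> j a, n) - frag_of (u, a \<odot>\<^bsub>N\<^esub> n) |u a n.
        u \<in> carrier R \<and> a \<in> carrier A \<and> n \<in> carrier N}"

definition tensor_kernel ::
    "('r, 'b) ring_scheme \<Rightarrow> ('a, 'c) ring_scheme \<Rightarrow> ('a \<Rightarrow> 'r) \<Rightarrow> ('a, 'n, 'd) module_scheme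
      \<Rightarrow> ('r \<times> 'n \<Rightarrow>\<^sub>0 int) set" where
  "tensor_kernel R A j N =
     generate (free_Abelian_group (carrier R \<times> carrier N)) (tensor_relations R A j N)"

definition pure_tensor ::
    "('r, 'b) ring_scheme \<Rightarrow> ('a, 'c) ring_scheme \<Rightarrow> ('a \<Rightarrow> 'r) \<Rightarrow> ('a, 'n, 'd) module_scheme
      \<Rightarrow> 'r \<Rightarrow> 'n \<Rightarrow> ('r \<times> 'n \<Rightarrow>\<^sub>0 int) set" where
  "pure_tensor R A j N u n =
     tensor_kernel R A j N #>\<^bsub>free_Abelian_group (carrier R \<times> carrier N)\<^esub> frag_of (u, n)"

text \<open>The scalar action sends \<open>r\<close> and the pure tensor of \<open>u\<close> and \<open>n\<close> to the pure tensor of the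
  product \<open>r u\<close> and \<open>n\<close>; \<open>frag_extend\<close> extends this additively.\<close>

definition tensor_module ::
    "('r, 'b) ring_scheme \<Rightarrow> ('a, 'c) ring_scheme \<Rightarrow> ('a \<Rightarrow> 'r) \<Rightarrow> ('a, 'n, 'd) module_scheme
      \<Rightarrow> ('r, ('r \<times> 'n \<Rightarrow>\<^sub>0 int) set) module" where
  "tensor_module R A j N =
    (let G = free_Abelian_group (carrier R \<times> carrier N); K = tensor_kernel R A j N in
     \<lparr>carrier = rcosets\<^bsub>G\<^esub> K, mult = undefined, one = undefined,
      zero = K, add = set_mult G,
      smult = (\<lambda>r X. \<Union>x\<in>X.
        K #>\<^bsub>G\<^esub> frag_extend (\<lambda>(u, n). frag_of (r \<otimes>\<^bsub>R\<^esub> u, n)) x)\<rparr>)"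


section \<open>Quasi-Whittaker modules\<close>

text \<open>The algebra homomorphism from the free algebra to the complex numbers extending \<open>\<phi>\<close>. It
  is constant on the classes in the enveloping algebra if \<open>\<phi>\<close> is a Lie character.\<close>

definition fa_eval :: "('a \<Rightarrow> complex) \<Rightarrow> 'a free_alg \<Rightarrow> complex" where
  "fa_eval \<phi> a = (\<Sum>w\<in>Poly_Mapping.keys a. Poly_Mapping.lookup a w * prod_list (map \<phi> (letters w)))"

definition character_module ::
    "(schrodinger \<Rightarrow> complex) \<Rightarrow> (schrodinger free_alg set, complex) module" where
  "character_module \<phi> =
    \<lparr>carrier = UNIV, mult = undefined, one = undefined, zero = 0, add = (+),
     smult = (\<lambda>X c. the_elem (fa_eval \<phi> ` X) * c)\<rparr>"

type_synonym quasi_whittaker_elem = "(schrodinger free_alg set \<times> complex \<Rightarrow>\<^sub>0 int) set"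

definition quasi_whittaker ::
    "(schrodinger \<Rightarrow> complex) \<Rightarrow> (schrodinger free_alg set, quasi_whittaker_elem) module" where
  "quasi_whittaker \<phi> =
     tensor_module (uea UNIV) (uea heisenberg) (uea_map UNIV) (character_module \<phi>)"

definition quasi_whittaker_gen :: "(schrodinger \<Rightarrow> complex) \<Rightarrow> quasi_whittaker_elem" where
  "quasi_whittaker_gen \<phi> =
     pure_tensor (uea UNIV) (uea heisenberg) (uea_map UNIV) (character_module \<phi>)
       \<one>\<^bsub>uea UNIV\<^esub> 1"

definition quasi_C :: "(schrodinger \<Rightarrow> complex) \<Rightarrow> schrodinger free_alg set" where
  "quasi_C \<phi> = uea_incl UNIV
     ((\<phi> sch_p)\<^sup>2 *s sch_f - (\<phi> sch_q)\<^sup>2 *s sch_e - (\<phi> sch_p * \<phi> sch_q) *s sch_h)"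

definition quasi_W :: "(schrodinger \<Rightarrow> complex) \<Rightarrow> complex \<Rightarrow> quasi_whittaker_elem set" where
  "quasi_W \<phi> \<xi> = cyclic_submodule (uea UNIV) (quasi_whittaker \<phi>)
     ((quasi_C \<phi> \<ominus>\<^bsub>uea UNIV\<^esub> uea_scalar UNIV \<xi>) \<odot>\<^bsub>quasi_whittaker \<phi>\<^esub> quasi_whittaker_gen \<phi>)"

definition quasi_L ::
    "(schrodinger \<Rightarrow> complex) \<Rightarrow> complex \<Rightarrow> (schrodinger free_alg set, quasi_whittaker_elem set) module" where
  "quasi_L \<phi> \<xi> = quotient_module (quasi_whittaker \<phi>) (quasi_W \<phi> \<xi>)"


section \<open>Well-definedness\<close>

text \<open>The enveloping algebras are rings, \<open>uea_map\<close> acts on representatives, and a Lie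
  character of the Heisenberg subalgebra induces a module structure on the complex numbers.\<close>

lemma free_algebra_ring: "ring (free_algebra L)"
proof (rule ringI)
  show "abelian_group (free_algebra L)"
  proof (rule abelian_groupI)
    fix x assume "x \<in> carrier (free_algebra L)"
    then show "\<exists>y\<in>carrier (free_algebra L). y \<oplus>\<^bsub>free_algebra L\<^esub> x = \<zero>\<^bsub>free_algebra L\<^esub>"
      by (intro bexI[of _ "- x"]) (simp_all add: free_algebra_def)
  qed (auto simp: free_algebra_def algebra_simps dest!: subsetD[OF Poly_Mapping.keys_add])
  show "Group.monoid (free_algebra L)"
  proof (rule monoidI)
    fix a b assume a: "a \<in> carrier (free_algebra L)" and b: "b \<in> carrier (free_algebra L)"
    show "a \<otimes>\<^bsub>free_algebra L\<^esub> b \<in> carrier (free_algebra L)"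
      using a b keys_mult[of a b]
      by (fastforce simp: free_algebra_def plus_free_monoid_def)
  qed (auto simp: free_algebra_def zero_free_monoid_def algebra_simps split: if_splits)
qed (auto simp: free_algebra_def algebra_simps)

lemma carrier_free_algebra: "a \<in> carrier (free_algebra L) \<longleftrightarrow> (\<forall>w\<in>Poly_Mapping.keys a. set (letters w) \<subseteq> L)"
  by (simp add: free_algebra_def)

lemma fa_var_closed: "x \<in> L \<Longrightarrow> fa_var x \<in> carrier (free_algebra L)"
  and fa_const_closed: "fa_const c \<in> carrier (free_algebra L)"
  by (auto simp: carrier_free_algebra fa_var_def fa_const_def zero_free_monoid_def split: if_splits)

lemma free_algebra_minus:
  assumes "a \<in> carrier (free_algebra L)"  "b \<in> carrier (free_algebra L)"
  shows "a - b \<in> carrier (free_algebra L)"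
  using assms keys_diff[of a b] by (auto simp: carrier_free_algebra)

lemma free_algebra_simps:
  "a \<otimes>\<^bsub>free_algebra L\<^esub> b = a * b" "a \<oplus>\<^bsub>free_algebra L\<^esub> b = a + b"
  "\<one>\<^bsub>free_algebra L\<^esub> = 1" "\<zero>\<^bsub>free_algebra L\<^esub> = 0"
  by (simp_all add: free_algebra_def)

lemma free_algebra_mult_closed:
  assumes "a \<in> carrier (free_algebra L)"  "b \<in> carrier (free_algebra L)"
  shows "a * b \<in> carrier (free_algebra L)"
  using monoid.m_closed[OF ring.is_monoid[OF free_algebra_ring] assms] by (simp add: free_algebra_simps)

lemma free_algebra_add_closed:
  assumes "a \<in> carrier (free_algebra L)"  "b \<in> carrier (free_algebra L)"
  shows "a + b \<in> carrier (free_algebra L)"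
  using ring.ring_simprules(1)[OF free_algebra_ring assms] by (simp add: free_algebra_simps)

definition lie_subalgebra :: "schrodinger set \<Rightarrow> bool" where
  "lie_subalgebra L \<longleftrightarrow> vec.subspace L \<and> (\<forall>x\<in>L. \<forall>y\<in>L. sch_bracket x y \<in> L)"

lemma uea_relations_closed:
  assumes "lie_subalgebra L"
  shows "uea_relations L \<subseteq> carrier (free_algebra L)"
  using assms
  by (auto simp: uea_relations_def lie_subalgebra_def vec.subspace_def
    intro!: free_algebra_minus free_algebra_add_closed free_algebra_mult_closed fa_var_closed fa_const_closed)

lemma uea_ideal: "lie_subalgebra L \<Longrightarrow> ideal (uea_ideal L) (free_algebra L)"
  unfolding uea_ideal_def by (rule ring.genideal_ideal[OF free_algebra_ring uea_relations_closed])

lemma uea_ring: "lie_subalgebra L \<Longrightarrow> ring (uea L)"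
  unfolding uea_def by (rule ideal.quotient_is_ring[OF uea_ideal])

lemma fa_eval_superset:
  assumes "finite A" "Poly_Mapping.keys a \<subseteq> A"
  shows "fa_eval \<phi> a = (\<Sum>w\<in>A. Poly_Mapping.lookup a w * prod_list (map \<phi> (letters w)))"
  unfolding fa_eval_def using assms
  by (intro sum.mono_neutral_left) (auto simp: in_keys_iff)

lemma fa_eval_add: "fa_eval \<phi> (a + b) = fa_eval \<phi> a + fa_eval \<phi> b"
proof -
  let ?A = "Poly_Mapping.keys a \<union> Poly_Mapping.keys b"
  show ?thesis
    using keys_add[of a b]
    by (simp add: fa_eval_superset[of ?A] lookup_add algebra_simps sum.distrib)
qed

lemma fa_eval_zero [simp]: "fa_eval \<phi> 0 = 0" by (simp add: fa_eval_def)

lemma fa_eval_single: "fa_eval \<phi> (Poly_Mapping.single w c) = c * prod_list (map \<phi> (letters w))"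
  by (simp add: fa_eval_def)

lemma fa_eval_minus: "fa_eval \<phi> (a - b) = fa_eval \<phi> a - fa_eval \<phi> b"
  using fa_eval_add[of \<phi> "a - b" b] by simp

lemma poly_mapping_add_single_induct:
  fixes a :: "'k \<Rightarrow>\<^sub>0 'v::monoid_add"
  assumes "P 0" "\<And>a w c. P a \<Longrightarrow> w \<notin> Poly_Mapping.keys a \<Longrightarrow> P (a + Poly_Mapping.single w c)"
  shows "P a"
proof -
  have *: "finite S \<Longrightarrow> \<forall>a. Poly_Mapping.keys a = S \<longrightarrow> P a" for S
  proof (induction S rule: finite_induct)
    case empty then show ?case using assms(1) by simp
  next
    case (insert x S)
    show ?case
    proof (intro allI impI)
      fix a :: "'k \<Rightarrow>\<^sub>0 'v" assume k: "Poly_Mapping.keys a = insert x S"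
      define b where "b = Poly_Mapping.update x 0 a"
      have "Poly_Mapping.keys b = S" using k insert.hyps by (auto simp: b_def in_keys_iff lookup_update split: if_splits)
      moreover have "a = b + Poly_Mapping.single x (Poly_Mapping.lookup a x)"
        by (rule poly_mapping_eqI) (simp add: b_def lookup_add lookup_update lookup_single when_def)
      ultimately show "P a" using insert assms(2) by metis
    qed
  qed
  from *[OF finite_keys] show ?thesis by blast
qed

lemma fa_eval_mult: "fa_eval \<phi> (a * b) = fa_eval \<phi> a * fa_eval \<phi> b"
proof (induction a rule: poly_mapping_add_single_induct)
  case (2 a w c)
  have "fa_eval \<phi> (Poly_Mapping.single w c * b) = fa_eval \<phi> (Poly_Mapping.single w c) * fa_eval \<phi> b"
  proof (induction b rule: poly_mapping_add_single_induct)
    case (2 b v d)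
    then show ?case
      by (simp add: distrib_left fa_eval_add mult_single fa_eval_single plus_free_monoid_def)
  qed auto
  with 2 show ?case by (simp add: distrib_right fa_eval_add)
qed auto

lemma fa_eval_one: "fa_eval \<phi> 1 = 1"
  using fa_eval_single[of \<phi> 0 1] by (simp add: zero_free_monoid_def flip: single_one)


lemma fa_eval_ideal:
  assumes L: "lie_subalgebra L" and \<phi>: "lie_character L \<phi>" and a: "a \<in> uea_ideal L"
  shows "fa_eval \<phi> a = 0"
proof -
  interpret ring "free_algebra L" by (rule free_algebra_ring)
  let ?K = "{a \<in> carrier (free_algebra L). fa_eval \<phi> a = 0}"
  have neg: "\<ominus>\<^bsub>free_algebra L\<^esub> x = - x" if "x \<in> carrier (free_algebra L)" for x
    using that by (intro minus_equality) (auto simp: free_algebra_simps carrier_free_algebra)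
  have "ideal ?K (free_algebra L)"
  proof (rule idealI[OF free_algebra_ring])
    show "subgroup ?K (add_monoid (free_algebra L))"
    proof (rule group.subgroupI)
      show "group (add_monoid (free_algebra L))" by (rule add.is_group)
      show "?K \<noteq> {}" by (auto intro!: exI[of _ 0] simp: carrier_free_algebra)
      fix x assume x: "x \<in> ?K"
      have "fa_eval \<phi> (- x) = 0" using fa_eval_minus[of \<phi> 0 x] x by simp
      with x neg[of x] a_inv_closed[of x] show "inv\<^bsub>add_monoid (free_algebra L)\<^esub> x \<in> ?K"
        by (simp add: a_inv_def)
    next
      fix x y assume "x \<in> ?K" "y \<in> ?K"
      then show "x \<otimes>\<^bsub>add_monoid (free_algebra L)\<^esub> y \<in> ?K"
        using free_algebra_add_closed[of x L y] by (simp add: free_algebra_simps fa_eval_add)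
    qed auto
  qed (auto simp: free_algebra_simps fa_eval_mult free_algebra_mult_closed)
  moreover have "uea_relations L \<subseteq> ?K"
  proof -
    have "fa_eval \<phi> a = 0" if "a \<in> uea_relations L" for a
      using that L \<phi>
      by (auto simp: uea_relations_def fa_eval_minus fa_eval_add fa_eval_mult fa_var_def fa_const_def
         fa_eval_single zero_free_monoid_def lie_character_def)
    then show ?thesis using uea_relations_closed[OF L] by blast
  qed
  ultimately have "uea_ideal L \<subseteq> ?K"
    unfolding uea_ideal_def by (rule genideal_minimal)
  with a show ?thesis by auto
qed

lemma fa_eval_coset:
  assumes L: "lie_subalgebra L" and \<phi>: "lie_character L \<phi>" and a: "a \<in> carrier (free_algebra L)"
  shows "the_elem (fa_eval \<phi> ` (uea_ideal L +>\<^bsub>free_algebra L\<^esub> a)) = fa_eval \<phi> a"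
proof -
  have "0 \<in> uea_ideal L" using additive_subgroup.zero_closed[OF ideal.axioms(1)[OF uea_ideal[OF L]]]
    by (simp add: free_algebra_simps)
  then have "fa_eval \<phi> ` (uea_ideal L +>\<^bsub>free_algebra L\<^esub> a) = {fa_eval \<phi> a}"
    by (auto simp: a_r_coset_def r_coset_def free_algebra_simps fa_eval_add fa_eval_ideal[OF L \<phi>] image_iff)
  then show ?thesis by simp
qed

lemma uea_carrierE:
  assumes "X \<in> carrier (uea L)"
  obtains a where "a \<in> carrier (free_algebra L)" "X = uea_ideal L +>\<^bsub>free_algebra L\<^esub> a"
  using assms by (auto simp: uea_def FactRing_def A_RCOSETS_def RCOSETS_def a_r_coset_def)

lemma uea_coset_ops:
  assumes L: "lie_subalgebra L" and "a \<in> carrier (free_algebra L)" "b \<in> carrier (free_algebra L)"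
  shows "(uea_ideal L +>\<^bsub>free_algebra L\<^esub> a) \<otimes>\<^bsub>uea L\<^esub> (uea_ideal L +>\<^bsub>free_algebra L\<^esub> b)
           = uea_ideal L +>\<^bsub>free_algebra L\<^esub> (a * b)"
    "(uea_ideal L +>\<^bsub>free_algebra L\<^esub> a) \<oplus>\<^bsub>uea L\<^esub> (uea_ideal L +>\<^bsub>free_algebra L\<^esub> b)
           = uea_ideal L +>\<^bsub>free_algebra L\<^esub> (a + b)"
    "\<one>\<^bsub>uea L\<^esub> = uea_ideal L +>\<^bsub>free_algebra L\<^esub> 1"
    using ideal.rcoset_mult_add[OF uea_ideal[OF L]] abelian_subgroup.a_rcos_sum[OF abelian_subgroupI3[OF ideal.axioms(1)[OF uea_ideal[OF L]] ring.is_abelian_group[OF free_algebra_ring]]] assms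
    by (simp_all add: uea_def FactRing_def free_algebra_simps)

lemma heisenberg_lie_subalgebra: "lie_subalgebra heisenberg"
  using heisenberg_bracket_closed by (auto simp: lie_subalgebra_def heisenberg_def vec.subspace_span)

lemma UNIV_lie_subalgebra: "lie_subalgebra UNIV"
  by (auto simp: lie_subalgebra_def)

lemma character_left_module:
  assumes \<phi>: "lie_character heisenberg \<phi>"
  shows "left_module (uea heisenberg) (character_module \<phi>)"
proof -
  note L = heisenberg_lie_subalgebra
  have ag: "abelian_group (character_module \<phi>)"
    by (rule abelian_groupI) (auto simp: character_module_def intro: exI[of _ "- x" for x])
  interpret ring "uea heisenberg" by (rule uea_ring[OF L])
  interpret abelian_group "character_module \<phi>" by (rule ag)
  show ?thesis
  proof
    have one: "(1 :: schrodinger free_alg) \<in> carrier (free_algebra heisenberg)"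
      using ring.ring_simprules(6)[OF free_algebra_ring] by (simp add: free_algebra_simps)
    show "\<one>\<^bsub>uea heisenberg\<^esub> \<odot>\<^bsub>character_module \<phi>\<^esub> x = x" for x
      using one by (simp add: character_module_def uea_coset_ops(3)[OF L one one] fa_eval_coset[OF L \<phi>] fa_eval_one)
  qed (auto elim!: uea_carrierE simp: uea_coset_ops[OF L] fa_eval_coset[OF L \<phi>] character_module_def
      fa_eval_add fa_eval_mult algebra_simps free_algebra_add_closed free_algebra_mult_closed)
qed

lemma free_algebra_mono: "L \<subseteq> L' \<Longrightarrow> carrier (free_algebra L) \<subseteq> carrier (free_algebra L')"
  by (fastforce simp: carrier_free_algebra)

lemma uea_map_coset:
  assumes L: "lie_subalgebra L" and a: "a \<in> carrier (free_algebra L)"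
  shows "uea_map UNIV (uea_ideal L +>\<^bsub>free_algebra L\<^esub> a) = uea_ideal UNIV +>\<^bsub>free_algebra UNIV\<^esub> a"
proof -
  note U = UNIV_lie_subalgebra
  interpret I: ideal "uea_ideal UNIV" "free_algebra UNIV" by (rule uea_ideal[OF U])
  interpret R: ring "free_algebra L" by (rule free_algebra_ring)
  have all: "x \<in> carrier (free_algebra UNIV)" for x :: "schrodinger free_alg" by (simp add: carrier_free_algebra)
  have neg: "\<ominus>\<^bsub>free_algebra L\<^esub> x = - x" if "x \<in> carrier (free_algebra L)" for x
    using that by (intro R.minus_equality) (auto simp: free_algebra_simps carrier_free_algebra)
  let ?K = "uea_ideal UNIV \<inter> carrier (free_algebra L)"
  have negU: "- x \<in> uea_ideal UNIV" if "x \<in> uea_ideal UNIV" for x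
  proof -
    have "\<ominus>\<^bsub>free_algebra UNIV\<^esub> x = - x"
      by (rule I.minus_equality) (auto simp: free_algebra_simps all)
    then show ?thesis using additive_subgroup.a_inv_closed[OF I.additive_subgroup_axioms that] by simp
  qed
  have "ideal ?K (free_algebra L)"
  proof (rule idealI[OF free_algebra_ring])
    show "subgroup ?K (add_monoid (free_algebra L))"
    proof (rule group.subgroupI)
      show "group (add_monoid (free_algebra L))" by (rule R.add.is_group)
      show "?K \<noteq> {}" using additive_subgroup.zero_closed[OF I.additive_subgroup_axioms] R.zero_closed
        unfolding free_algebra_simps by blast
      fix x assume x: "x \<in> ?K"
      with neg[of x] R.a_inv_closed[of x] negU show "inv\<^bsub>add_monoid (free_algebra L)\<^esub> x \<in> ?K"
        by (simp add: a_inv_def)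
    next
      fix x y assume "x \<in> ?K" "y \<in> ?K"
      then show "x \<otimes>\<^bsub>add_monoid (free_algebra L)\<^esub> y \<in> ?K"
        using free_algebra_add_closed[of x L y] additive_subgroup.a_closed[OF I.additive_subgroup_axioms, of x y] by (simp add: free_algebra_simps)
    qed auto
  next
    fix a x assume "a \<in> ?K" "x \<in> carrier (free_algebra L)"
    then show "x \<otimes>\<^bsub>free_algebra L\<^esub> a \<in> ?K" "a \<otimes>\<^bsub>free_algebra L\<^esub> x \<in> ?K"
      using I.I_l_closed[of a x] I.I_r_closed[of a x] all free_algebra_mult_closed by (auto simp: free_algebra_simps)
  qed
  moreover have "uea_relations L \<subseteq> uea_relations UNIV" by (fastforce simp: uea_relations_def)
  then have "uea_relations L \<subseteq> ?K"
    using uea_relations_closed[OF L] I.genideal_self[OF uea_relations_closed[OF U]] by (auto simp: uea_ideal_def)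
  ultimately have sub: "uea_ideal L \<subseteq> uea_ideal UNIV"
    using R.genideal_minimal[of ?K "uea_relations L"] unfolding uea_ideal_def[of L] by blast
  have "0 \<in> uea_ideal L" using additive_subgroup.zero_closed[OF ideal.axioms(1)[OF uea_ideal[OF L]]]
    by (simp add: free_algebra_simps)
  then have mem: "a \<in> uea_ideal L +>\<^bsub>free_algebra L\<^esub> a"
    by (auto simp: a_r_coset_def r_coset_def free_algebra_simps)
  have "uea_ideal UNIV +>\<^bsub>free_algebra UNIV\<^esub> x = uea_ideal UNIV +>\<^bsub>free_algebra UNIV\<^esub> a"
    if "x \<in> uea_ideal L +>\<^bsub>free_algebra L\<^esub> a" for x
  proof -
    have "x \<in> uea_ideal UNIV +>\<^bsub>free_algebra UNIV\<^esub> a"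
      using that sub by (auto simp: a_r_coset_def r_coset_def free_algebra_simps)
    then show ?thesis by (rule I.a_repr_independence'[symmetric]) (rule all)
  qed
  with mem show ?thesis unfolding uea_map_def by blast
qed
end

theory Submission
  imports Defs "HOL-Computational_Algebra.Polynomial"
begin

text \<open>Write \<open>a\<close> and \<open>b\<close> for the values of \<open>\<phi>\<close> at \<open>p\<close> and \<open>q\<close>, and choose \<open>c\<close>, \<open>d\<close> with
  \<open>a * c + b * d = 1\<close>. The group SL(2) acts on the Schroedinger algebra by automorphisms, and the
  automorphism \<open>twist a b c d\<close> carries the standard basis to one, written \<open>e', h', f', p', q', z\<close>,
  for which \<open>\<phi>\<close> is \<open>1\<close> at \<open>p'\<close> and \<open>0\<close> at \<open>q'\<close>, while \<open>f'\<close> is the element \<open>C\<close>. Hence the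
  quotient of \<open>M\<close> by \<open>W\<close> is generated by a vector \<open>w\<close> with \<open>p' w = w\<close>, \<open>q' w = 0\<close>, \<open>z w = 0\<close> and
  \<open>f' w = \<xi> w\<close>, and it is spanned by the vectors \<open>e'^i h'^j w\<close>.

  Moving generators past \<open>e'^i h'^j\<close> suggests how they ought to act on polynomials in two
  variables \<open>t\<close> and \<open>s\<close>, where \<open>t^i s^j\<close> stands for \<open>e'^i h'^j w\<close>. The resulting operators \<open>wh_op\<close>
  do satisfy the commutation relations (\<open>wh_rep_bracket\<close>), so there is a module homomorphism from
  \<open>M\<close> to this model that sends \<open>w\<close> to \<open>1\<close> and kills \<open>W\<close>; in particular \<open>W\<close> is proper. Its
  kernel is exactly \<open>W\<close> (\<open>vec_of_mem_W_iff\<close>): in the free algebra, every \<open>u\<close> is congruent to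
  the noncommutative polynomial that the value \<open>u 1\<close> of \<open>u\<close> in the model spells out
  (\<open>normal_form\<close>), modulo the left ideal of all elements that send \<open>w\<close> into \<open>W\<close>. So if
  \<open>u 1 = 0\<close>, then \<open>u w\<close> lies in \<open>W\<close>.

  The model is irreducible (\<open>act_transitive\<close>): up to a shift of \<open>s\<close> and a sign, \<open>q'\<close>
  differentiates in \<open>t\<close>, and \<open>p' - 1\<close> is a difference operator in \<open>s\<close>, so a nonzero polynomial can
  be lowered to a nonzero constant. A submodule strictly containing \<open>W\<close> has an element \<open>u w\<close> with
  \<open>u 1\<close> nonzero. Taking \<open>v\<close> with \<open>v u 1 = 1\<close>, the element \<open>w - v u w\<close> is in \<open>W\<close>, so \<open>w\<close> lies in the
  submodule, which is therefore everything. Simplicity of the quotient is the correspondence of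
  submodules (\<open>maximal_submodule_simple_quotient\<close>).\<close>

section \<open>Left modules and their quotients\<close>

text \<open>Negation is multiplication by the scalar \<open>-1\<close>, so closure under it is automatic.\<close>

lemma left_module_submoduleI:
  assumes M: "left_module R M" and "H \<subseteq> carrier M" "H \<noteq> {}"
    and add: "\<And>x y. x \<in> H \<Longrightarrow> y \<in> H \<Longrightarrow> x \<oplus>\<^bsub>M\<^esub> y \<in> H"
    and smult: "\<And>r x. r \<in> carrier R \<Longrightarrow> x \<in> H \<Longrightarrow> r \<odot>\<^bsub>M\<^esub> x \<in> H"
  shows "submodule H R M"
proof -
  interpret left_module R M by (rule M)
  have sub: "x \<in> carrier M" if "x \<in> H" for x using that assms(2) by blast
  have inv: "\<ominus>\<^bsub>M\<^esub> x \<in> H" if "x \<in> H" for x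
  proof -
    have x: "x \<in> carrier M" by (rule sub[OF that])
    have "\<zero>\<^bsub>R\<^esub> \<odot>\<^bsub>M\<^esub> x \<oplus>\<^bsub>M\<^esub> \<zero>\<^bsub>R\<^esub> \<odot>\<^bsub>M\<^esub> x = \<zero>\<^bsub>R\<^esub> \<odot>\<^bsub>M\<^esub> x \<oplus>\<^bsub>M\<^esub> \<zero>\<^bsub>M\<^esub>"
      using smult_l_distr[of "\<zero>\<^bsub>R\<^esub>" "\<zero>\<^bsub>R\<^esub>" x] x by simp
    then have "\<zero>\<^bsub>R\<^esub> \<odot>\<^bsub>M\<^esub> x = \<zero>\<^bsub>M\<^esub>" using x by (simp del: M.r_zero)
    then have "(\<ominus>\<^bsub>R\<^esub> \<one>\<^bsub>R\<^esub>) \<odot>\<^bsub>M\<^esub> x \<oplus>\<^bsub>M\<^esub> x = \<zero>\<^bsub>M\<^esub>"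
      using x smult_l_distr[of "\<ominus>\<^bsub>R\<^esub> \<one>\<^bsub>R\<^esub>" "\<one>\<^bsub>R\<^esub>" x] by (simp add: R.l_neg)
    then have "\<ominus>\<^bsub>M\<^esub> x = (\<ominus>\<^bsub>R\<^esub> \<one>\<^bsub>R\<^esub>) \<odot>\<^bsub>M\<^esub> x"
      using M.minus_equality x by simp
    then show ?thesis using smult[OF _ that, of "\<ominus>\<^bsub>R\<^esub> \<one>\<^bsub>R\<^esub>"] by simp
  qed
  obtain x where x: "x \<in> H" using assms(3) by blast
  have zero: "\<zero>\<^bsub>M\<^esub> \<in> H"
    using add[OF x inv[OF x]] sub[OF x] by (simp add: M.r_neg)
  show ?thesis
  proof (intro submodule.intro subgroup.intro)
    show "submodule_axioms H R M" by standard (rule smult)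
    show "inv\<^bsub>add_monoid M\<^esub> x \<in> H" if "x \<in> H" for x using inv[OF that] by (simp add: a_inv_def)
  qed (use assms(2) zero add in simp_all)
qed

text \<open>Tensor products and quotients of modules are both commutative groups modulo a subgroup, on
  which scalars act through representatives. For the tensor product the group upstairs, a free
  abelian group, is not a module: there the module laws hold only modulo the subgroup, which is why
  the hypotheses compare cosets.\<close>

lemma quotient_left_module:
  fixes G :: "('g, 'c) monoid_scheme" and act :: "'a \<Rightarrow> 'g \<Rightarrow> 'g"
  assumes R: "ring R" and G: "comm_group G" and K: "subgroup K G"
    and hom: "\<And>r. r \<in> carrier R \<Longrightarrow> act r \<in> hom G G"
    and stable: "\<And>r x. r \<in> carrier R \<Longrightarrow> x \<in> K \<Longrightarrow> act r x \<in> K"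
    and distr: "\<And>r s x. r \<in> carrier R \<Longrightarrow> s \<in> carrier R \<Longrightarrow> x \<in> carrier G \<Longrightarrow>
      K #>\<^bsub>G\<^esub> act (r \<oplus>\<^bsub>R\<^esub> s) x = K #>\<^bsub>G\<^esub> (act r x \<otimes>\<^bsub>G\<^esub> act s x)"
    and assoc: "\<And>r s x. r \<in> carrier R \<Longrightarrow> s \<in> carrier R \<Longrightarrow> x \<in> carrier G \<Longrightarrow>
      K #>\<^bsub>G\<^esub> act (r \<otimes>\<^bsub>R\<^esub> s) x = K #>\<^bsub>G\<^esub> act r (act s x)"
    and one: "\<And>x. x \<in> carrier G \<Longrightarrow> K #>\<^bsub>G\<^esub> act \<one>\<^bsub>R\<^esub> x = K #>\<^bsub>G\<^esub> x"
  defines "M \<equiv> \<lparr>carrier = rcosets\<^bsub>G\<^esub> K, monoid.mult = undefined, one = undefined,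
      ring.zero = K, add = set_mult G, module.smult = (\<lambda>r X. \<Union>x\<in>X. K #>\<^bsub>G\<^esub> act r x)\<rparr>"
  shows "left_module R M"
    and "\<And>r x. r \<in> carrier R \<Longrightarrow> x \<in> carrier G \<Longrightarrow> r \<odot>\<^bsub>M\<^esub> (K #>\<^bsub>G\<^esub> x) = K #>\<^bsub>G\<^esub> act r x"
    and "\<And>x y. x \<in> carrier G \<Longrightarrow> y \<in> carrier G \<Longrightarrow>
      (K #>\<^bsub>G\<^esub> x) \<oplus>\<^bsub>M\<^esub> (K #>\<^bsub>G\<^esub> y) = K #>\<^bsub>G\<^esub> (x \<otimes>\<^bsub>G\<^esub> y)"
proof -
  interpret R: ring R by (rule R)
  interpret G: comm_group G by (rule G)
  interpret K: subgroup K G by (rule K)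
  interpret N: normal K G by (rule G.subgroup_imp_normal[OF K])
  have car: "act r x \<in> carrier G" if "r \<in> carrier R" "x \<in> carrier G" for r x
    using hom[OF that(1)] that(2) by (auto simp: hom_def)
  have mult: "act r (x \<otimes>\<^bsub>G\<^esub> y) = act r x \<otimes>\<^bsub>G\<^esub> act r y"
    if "r \<in> carrier R" "x \<in> carrier G" "y \<in> carrier G" for r x y
    using hom[OF that(1)] that(2,3) by (auto simp: hom_def)
  show smult: "r \<odot>\<^bsub>M\<^esub> (K #>\<^bsub>G\<^esub> x) = K #>\<^bsub>G\<^esub> act r x" if r: "r \<in> carrier R" and x: "x \<in> carrier G" for r x
  proof -
    have "K #>\<^bsub>G\<^esub> act r y = K #>\<^bsub>G\<^esub> act r x" if y: "y \<in> K #>\<^bsub>G\<^esub> x" for y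
    proof -
      from y obtain k where k: "k \<in> K" "y = k \<otimes>\<^bsub>G\<^esub> x" by (auto simp: r_coset_def)
      then have "act r y = act r k \<otimes>\<^bsub>G\<^esub> act r x" using mult[OF r] x by simp
      then have "act r y \<in> K #>\<^bsub>G\<^esub> act r x" using stable[OF r k(1)] by (auto simp: r_coset_def)
      then show ?thesis
        using G.repr_independence[OF _ car[OF r x] K] by simp
    qed
    moreover have "x \<in> K #>\<^bsub>G\<^esub> x" by (rule G.rcos_self[OF x K])
    ultimately have "(\<Union>y\<in>K #>\<^bsub>G\<^esub> x. K #>\<^bsub>G\<^esub> act r y) = K #>\<^bsub>G\<^esub> act r x" by blast
    then show ?thesis by (simp add: M_def)
  qed
  show add: "(K #>\<^bsub>G\<^esub> x) \<oplus>\<^bsub>M\<^esub> (K #>\<^bsub>G\<^esub> y) = K #>\<^bsub>G\<^esub> (x \<otimes>\<^bsub>G\<^esub> y)"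
    if "x \<in> carrier G" "y \<in> carrier G" for x y
    using N.rcos_sum[OF that] by (simp add: M_def)
  interpret F: comm_group "G Mod K" by (rule G.abelian_FactGroup[OF K])
  have F: "carrier (G Mod K) = carrier M" "monoid.mult (G Mod K) = add M"
    "one (G Mod K) = ring.zero M"
    by (simp_all add: M_def FactGroup_def)
  interpret M: abelian_group M
  proof (rule abelian_groupI)
    fix X assume "X \<in> carrier M"
    then show "\<exists>Y\<in>carrier M. Y \<oplus>\<^bsub>M\<^esub> X = \<zero>\<^bsub>M\<^esub>"
      using F.l_inv[of X] F.inv_closed[of X] unfolding F by blast
  qed (use F.m_closed[unfolded F] F.m_assoc[unfolded F] F.m_comm[unfolded F] F.l_one[unfolded F]
      F.one_closed[unfolded F] in blast)+
  have carM: "\<exists>x\<in>carrier G. X = K #>\<^bsub>G\<^esub> x" if "X \<in> carrier M" for X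
    using that by (auto simp: M_def RCOSETS_def)
  have inM: "K #>\<^bsub>G\<^esub> x \<in> carrier M" if "x \<in> carrier G" for x
    using that by (auto simp: M_def RCOSETS_def)
  show "left_module R M"
  proof
    fix a X assume "a \<in> carrier R" "X \<in> carrier M"
    then show "a \<odot>\<^bsub>M\<^esub> X \<in> carrier M"
      using carM[of X] by (auto simp: smult intro!: inM car)
  next
    fix a b X assume "a \<in> carrier R" "b \<in> carrier R" "X \<in> carrier M"
    then show "(a \<oplus>\<^bsub>R\<^esub> b) \<odot>\<^bsub>M\<^esub> X = a \<odot>\<^bsub>M\<^esub> X \<oplus>\<^bsub>M\<^esub> b \<odot>\<^bsub>M\<^esub> X"
      "(a \<otimes>\<^bsub>R\<^esub> b) \<odot>\<^bsub>M\<^esub> X = a \<odot>\<^bsub>M\<^esub> (b \<odot>\<^bsub>M\<^esub> X)"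
      using carM[of X] by (auto simp: smult add car distr assoc)
  next
    fix a X Y assume "a \<in> carrier R" "X \<in> carrier M" "Y \<in> carrier M"
    then show "a \<odot>\<^bsub>M\<^esub> (X \<oplus>\<^bsub>M\<^esub> Y) = a \<odot>\<^bsub>M\<^esub> X \<oplus>\<^bsub>M\<^esub> a \<odot>\<^bsub>M\<^esub> Y"
      using carM[of X] carM[of Y] by (auto simp: smult add car mult)
  next
    fix X assume "X \<in> carrier M"
    then show "\<one>\<^bsub>R\<^esub> \<odot>\<^bsub>M\<^esub> X = X" using carM[of X] by (auto simp: smult one)
  qed
qed

lemma quotient_module_left_module:
  assumes M: "left_module R M" and N: "submodule N R M"
  shows "left_module R (quotient_module M N)"
    and "\<And>r x. r \<in> carrier R \<Longrightarrow> x \<in> carrier M \<Longrightarrow>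
      r \<odot>\<^bsub>quotient_module M N\<^esub> (N +>\<^bsub>M\<^esub> x) = N +>\<^bsub>M\<^esub> (r \<odot>\<^bsub>M\<^esub> x)"
    and "\<And>x y. x \<in> carrier M \<Longrightarrow> y \<in> carrier M \<Longrightarrow>
      (N +>\<^bsub>M\<^esub> x) \<oplus>\<^bsub>quotient_module M N\<^esub> (N +>\<^bsub>M\<^esub> y) = N +>\<^bsub>M\<^esub> (x \<oplus>\<^bsub>M\<^esub> y)"
proof -
  interpret M: left_module R M by (rule M)
  interpret N: submodule N R M by (rule N)
  note defs = quotient_module_def A_RCOSETS_def a_r_coset_def set_add_def
  note * = quotient_left_module[of R "add_monoid M" N "module.smult M", OF M.R.ring_axioms M.M.a_comm_group N.subgroup_axioms]
  have 1: "module.smult M r \<in> hom (add_monoid M) (add_monoid M)" if "r \<in> carrier R" for r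
    using that by (auto simp: hom_def M.smult_r_distr)
  show "left_module R (quotient_module M N)"
    using *(1)[OF 1] by (auto simp: defs M.smult_l_distr M.smult_assoc)
  show "r \<odot>\<^bsub>quotient_module M N\<^esub> (N +>\<^bsub>M\<^esub> x) = N +>\<^bsub>M\<^esub> (r \<odot>\<^bsub>M\<^esub> x)"
    if "r \<in> carrier R" "x \<in> carrier M" for r x
    using *(2)[OF 1] that by (auto simp: defs M.smult_l_distr M.smult_assoc)
  show "(N +>\<^bsub>M\<^esub> x) \<oplus>\<^bsub>quotient_module M N\<^esub> (N +>\<^bsub>M\<^esub> y) = N +>\<^bsub>M\<^esub> (x \<oplus>\<^bsub>M\<^esub> y)"
    if "x \<in> carrier M" "y \<in> carrier M" for x y
    using *(3)[OF 1] that by (auto simp: defs M.smult_l_distr M.smult_assoc)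
qed

text \<open>The preimage in \<open>M\<close> of a submodule of the quotient lies between \<open>N\<close> and \<open>M\<close>.\<close>

lemma maximal_submodule_simple_quotient:
  assumes max: "maximal_submodule N R M"
  shows "simple_module R (quotient_module M N)"
proof -
  have M: "left_module R M" and N: "submodule N R M" and ne: "N \<noteq> carrier M"
    and top: "\<And>N'. submodule N' R M \<Longrightarrow> N \<subseteq> N' \<Longrightarrow> N' = N \<or> N' = carrier M"
    using max by (auto simp: maximal_submodule_def)
  interpret M: left_module R M by (rule M)
  interpret N: submodule N R M by (rule N)
  let ?Q = "quotient_module M N"
  note Q = quotient_module_left_module[OF M N]
  interpret Q: left_module R ?Q by (rule Q(1))
  have zero: "\<zero>\<^bsub>?Q\<^esub> = N" by (simp add: quotient_module_def)
  have carQ: "\<exists>x\<in>carrier M. X = N +>\<^bsub>M\<^esub> x" if "X \<in> carrier ?Q" for X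
    using that by (auto simp: quotient_module_def A_RCOSETS_def RCOSETS_def a_r_coset_def)
  have inQ: "N +>\<^bsub>M\<^esub> x \<in> carrier ?Q" if "x \<in> carrier M" for x
    using that by (auto simp: quotient_module_def A_RCOSETS_def RCOSETS_def a_r_coset_def)
  have coset_zero: "N +>\<^bsub>M\<^esub> x = N \<longleftrightarrow> x \<in> N" if "x \<in> carrier M" for x
    using M.M.add.coset_join1[OF _ _ N.subgroup_axioms, of x] that N.subset
      M.M.add.coset_join2[OF that N.subgroup_axioms] by (auto simp: a_r_coset_def)
  have "carrier ?Q \<noteq> {\<zero>\<^bsub>?Q\<^esub>}"
  proof
    assume "carrier ?Q = {\<zero>\<^bsub>?Q\<^esub>}"
    then have "x \<in> N" if "x \<in> carrier M" for x
      using inQ[OF that] coset_zero[OF that] zero by auto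
    with ne N.subset show False by auto
  qed
  moreover have "S = {\<zero>\<^bsub>?Q\<^esub>} \<or> S = carrier ?Q" if S: "submodule S R ?Q" for S
  proof -
    interpret S: submodule S R ?Q by (rule S)
    have Ssub: "S \<subseteq> carrier ?Q" using S.subset by simp
    let ?P = "{x \<in> carrier M. N +>\<^bsub>M\<^esub> x \<in> S}"
    have add: "x \<oplus>\<^bsub>M\<^esub> y \<in> ?P" if "x \<in> ?P" "y \<in> ?P" for x y
      using that S.m_closed[of "N +>\<^bsub>M\<^esub> x" "N +>\<^bsub>M\<^esub> y"] by (auto simp: Q(3))
    have smul: "r \<odot>\<^bsub>M\<^esub> x \<in> ?P" if "r \<in> carrier R" "x \<in> ?P" for r x
      using that S.smult_closed[of r "N +>\<^bsub>M\<^esub> x"] by (auto simp: Q(2))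
    have sub: "N \<subseteq> ?P"
    proof
      fix x assume "x \<in> N"
      moreover from this have "x \<in> carrier M" using N.subset by auto
      ultimately show "x \<in> ?P" using coset_zero[of x] S.one_closed zero by simp
    qed
    have "submodule ?P R M"
      by (rule left_module_submoduleI[OF M]) (use add smul sub N.one_closed in auto)
    from top[OF this sub] consider "?P = N" | "?P = carrier M" by blast
    then show ?thesis
    proof cases
      case 1
      have "X = N" if X: "X \<in> S" for X
      proof -
        obtain x where x: "x \<in> carrier M" "X = N +>\<^bsub>M\<^esub> x" using X Ssub carQ[of X] by blast
        with X 1 have "x \<in> N" by auto
        with coset_zero[OF x(1)] x(2) show ?thesis by simp
      qed
      moreover have "N \<in> S" using S.one_closed zero by simp
      ultimately have "S = {N}" by blast
      then show ?thesis using zero by simp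
    next
      case 2
      have "X \<in> S" if "X \<in> carrier ?Q" for X using carQ[OF that] 2 by blast
      with Ssub show ?thesis by blast
    qed
  qed
  ultimately show ?thesis using Q(1) by (simp add: simple_module_def)
qed

section \<open>Tensor products over noncommutative rings\<close>

lemma free_Abelian_coset_eq:
  assumes K: "subgroup K (free_Abelian_group S)" and "Poly_Mapping.keys y \<subseteq> S" and "x - y \<in> K"
  shows "K #>\<^bsub>free_Abelian_group S\<^esub> x = K #>\<^bsub>free_Abelian_group S\<^esub> y"
proof -
  have "x = (x - y) + y" by simp
  then have "x \<in> K #>\<^bsub>free_Abelian_group S\<^esub> y"
    unfolding r_coset_def using assms(3) by (auto intro!: bexI[of _ "x - y"])
  then show ?thesis
    using group.repr_independence[OF group_free_Abelian_group _ _ K] assms(2) by simp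
qed

lemma free_Abelian_subgroup:
  assumes K: "subgroup K (free_Abelian_group S)"
  shows "0 \<in> K" "x \<in> K \<Longrightarrow> y \<in> K \<Longrightarrow> x + y \<in> K" "x \<in> K \<Longrightarrow> y \<in> K \<Longrightarrow> x - y \<in> K"
    "x \<in> K \<Longrightarrow> Poly_Mapping.keys x \<subseteq> S"
proof -
  interpret K: subgroup K "free_Abelian_group S" by (rule K)
  show "0 \<in> K" using K.one_closed by simp
  show add: "x \<in> K \<Longrightarrow> y \<in> K \<Longrightarrow> x + y \<in> K" for x y using K.m_closed by simp
  show keys: "x \<in> K \<Longrightarrow> Poly_Mapping.keys x \<subseteq> S" for x
    using K.mem_carrier[of x] by simp
  have "- y \<in> K" if "y \<in> K" for y using K.m_inv_closed[OF that] keys[OF that] by simp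
  then show "x \<in> K \<Longrightarrow> y \<in> K \<Longrightarrow> x - y \<in> K" using add[of x "- y"] by simp
qed

locale tensor_product = R: ring R + N: left_module A N
  for R :: "('r, 'b) ring_scheme" and A :: "('a, 'c) ring_scheme" and j :: "'a \<Rightarrow> 'r"
    and N :: "('a, 'n, 'd) module_scheme" +
  assumes j_closed: "a \<in> carrier A \<Longrightarrow> j a \<in> carrier R"
begin

abbreviation "S \<equiv> carrier R \<times> carrier N"
abbreviation "F \<equiv> free_Abelian_group S"
abbreviation "K \<equiv> tensor_kernel R A j N"
abbreviation "T \<equiv> tensor_module R A j N"
abbreviation "lmul r \<equiv> frag_extend (\<lambda>(u, n). frag_of (r \<otimes>\<^bsub>R\<^esub> u, n))"

lemma relations_closed: "tensor_relations R A j N \<subseteq> carrier F"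
  unfolding tensor_relations_def
  by (auto simp: j_closed keys_frag_of dest!: subsetD[OF keys_diff] subsetD[OF keys_add])

lemma kernel_subgroup: "subgroup K F"
  unfolding tensor_kernel_def by (rule group.generate_is_subgroup[OF group_free_Abelian_group relations_closed])

lemmas kernel_closed = free_Abelian_subgroup[OF kernel_subgroup]
lemmas coset_eqI = free_Abelian_coset_eq[OF kernel_subgroup]

lemma relation_mem: "x \<in> tensor_relations R A j N \<Longrightarrow> x \<in> K"
  unfolding tensor_kernel_def by (rule generate.incl)

lemma kernel_add_left: "u \<in> carrier R \<Longrightarrow> v \<in> carrier R \<Longrightarrow> n \<in> carrier N \<Longrightarrow>
    frag_of (u \<oplus>\<^bsub>R\<^esub> v, n) - (frag_of (u, n) + frag_of (v, n)) \<in> K"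
  and kernel_add_right: "u \<in> carrier R \<Longrightarrow> m \<in> carrier N \<Longrightarrow> n \<in> carrier N \<Longrightarrow>
    frag_of (u, m \<oplus>\<^bsub>N\<^esub> n) - (frag_of (u, m) + frag_of (u, n)) \<in> K"
  and kernel_balanced: "u \<in> carrier R \<Longrightarrow> a \<in> carrier A \<Longrightarrow> n \<in> carrier N \<Longrightarrow>
    frag_of (u \<otimes>\<^bsub>R\<^esub> j a, n) - frag_of (u, a \<odot>\<^bsub>N\<^esub> n) \<in> K"
  by (rule relation_mem, unfold tensor_relations_def, blast)+

lemma kernel_induct [consumes 1, case_names zero relation diff]:
  assumes "x \<in> K" "P 0" "\<And>x. x \<in> tensor_relations R A j N \<Longrightarrow> P x"
    "\<And>x y. x \<in> K \<Longrightarrow> y \<in> K \<Longrightarrow> P x \<Longrightarrow> P y \<Longrightarrow> P (x - y)"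
  shows "P x"
proof -
  have neg: "P (- y)" if "y \<in> K" "P y" for y using assms(4)[OF kernel_closed(1) that(1) assms(2) that(2)] by simp
  have "x \<in> generate F (tensor_relations R A j N)" using assms(1) by (simp add: tensor_kernel_def)
  then show ?thesis
  proof (induction rule: generate.induct)
    case one
    then show ?case using assms(2) by simp
  next
    case (incl h)
    then show ?case by (rule assms(3))
  next
    case (inv h)
    then show ?case using neg[OF relation_mem assms(3)] relations_closed by (auto simp: subset_iff)
  next
    case (eng x y)
    then have "x \<in> K" "y \<in> K" by (simp_all add: tensor_kernel_def)
    moreover have "- y \<in> K" using kernel_closed(3)[OF kernel_closed(1) \<open>y \<in> K\<close>] by simp
    ultimately show ?case using assms(4)[of x "- y"] neg[of y] eng by simp
  qed
qed

lemma lmul_closed: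
  assumes "r \<in> carrier R" "Poly_Mapping.keys x \<subseteq> S"
  shows "Poly_Mapping.keys (lmul r x) \<subseteq> S"
  using assms by (intro order_trans[OF keys_frag_extend]) (auto simp: keys_frag_of)

text \<open>Left multiplication carries each relation to a relation of the same kind.\<close>

lemma lmul_kernel:
  assumes r: "r \<in> carrier R" and x: "x \<in> K"
  shows "lmul r x \<in> K"
  using x
proof (induction rule: kernel_induct)
  case (relation x)
  then show ?case
    unfolding tensor_relations_def
  proof (elim UnE CollectE exE conjE)
    fix u v n
    assume x: "x = frag_of (u \<oplus>\<^bsub>R\<^esub> v, n) - (frag_of (u, n) + frag_of (v, n))"
      and "u \<in> carrier R" "v \<in> carrier R" "n \<in> carrier N"
    then have "frag_of (r \<otimes>\<^bsub>R\<^esub> u \<oplus>\<^bsub>R\<^esub> r \<otimes>\<^bsub>R\<^esub> v, n)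
        - (frag_of (r \<otimes>\<^bsub>R\<^esub> u, n) + frag_of (r \<otimes>\<^bsub>R\<^esub> v, n)) \<in> K"
      using r by (intro kernel_add_left R.m_closed)
    then show ?thesis
      using r \<open>u \<in> carrier R\<close> \<open>v \<in> carrier R\<close>
      by (simp only: x frag_extend_diff frag_extend_add frag_extend_of prod.case R.r_distr)
  next
    fix u m n
    assume x: "x = frag_of (u, m \<oplus>\<^bsub>N\<^esub> n) - (frag_of (u, m) + frag_of (u, n))"
      and "u \<in> carrier R" "m \<in> carrier N" "n \<in> carrier N"
    then have "frag_of (r \<otimes>\<^bsub>R\<^esub> u, m \<oplus>\<^bsub>N\<^esub> n)
        - (frag_of (r \<otimes>\<^bsub>R\<^esub> u, m) + frag_of (r \<otimes>\<^bsub>R\<^esub> u, n)) \<in> K"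
      using r by (intro kernel_add_right R.m_closed)
    then show ?thesis
      by (simp only: x frag_extend_diff frag_extend_add frag_extend_of prod.case)
  next
    fix u a n
    assume x: "x = frag_of (u \<otimes>\<^bsub>R\<^esub> j a, n) - frag_of (u, a \<odot>\<^bsub>N\<^esub> n)"
      and "u \<in> carrier R" "a \<in> carrier A" "n \<in> carrier N"
    then have "frag_of ((r \<otimes>\<^bsub>R\<^esub> u) \<otimes>\<^bsub>R\<^esub> j a, n) - frag_of (r \<otimes>\<^bsub>R\<^esub> u, a \<odot>\<^bsub>N\<^esub> n) \<in> K"
      using r by (intro kernel_balanced R.m_closed)
    then show ?thesis
      using r \<open>u \<in> carrier R\<close> j_closed[OF \<open>a \<in> carrier A\<close>]
      by (simp only: x frag_extend_diff frag_extend_of prod.case R.m_assoc)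
  qed
next
  case (diff x y)
  then show ?case by (simp only: frag_extend_diff kernel_closed(3))
qed (simp add: kernel_closed)

text \<open>Of the module laws, additivity in the scalar is the one that needs the relations; the
  others hold already in the free abelian group.\<close>

lemma
  shows tensor_left_module: "left_module R T"
    and tensor_smult: "r \<in> carrier R \<Longrightarrow> Poly_Mapping.keys x \<subseteq> S \<Longrightarrow>
      r \<odot>\<^bsub>T\<^esub> (K #>\<^bsub>F\<^esub> x) = K #>\<^bsub>F\<^esub> lmul r x"
    and tensor_add: "Poly_Mapping.keys x \<subseteq> S \<Longrightarrow> Poly_Mapping.keys y \<subseteq> S \<Longrightarrow>
      (K #>\<^bsub>F\<^esub> x) \<oplus>\<^bsub>T\<^esub> (K #>\<^bsub>F\<^esub> y) = K #>\<^bsub>F\<^esub> (x + y)"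
proof -
  have hom: "lmul r \<in> hom F F" if "r \<in> carrier R" for r
    using lmul_closed[OF that] by (auto simp: hom_def frag_extend_add)
  have distr: "K #>\<^bsub>F\<^esub> lmul (r \<oplus>\<^bsub>R\<^esub> s) x = K #>\<^bsub>F\<^esub> (lmul r x \<otimes>\<^bsub>F\<^esub> lmul s x)"
    if r: "r \<in> carrier R" and s: "s \<in> carrier R" and x: "x \<in> carrier F" for r s x
  proof (rule coset_eqI)
    have keys: "Poly_Mapping.keys x \<subseteq> S" using x by simp
    show "Poly_Mapping.keys (lmul r x \<otimes>\<^bsub>F\<^esub> lmul s x) \<subseteq> S"
      using lmul_closed[OF r keys] lmul_closed[OF s keys] keys_add[of "lmul r x" "lmul s x"] by simp blast
    show "lmul (r \<oplus>\<^bsub>R\<^esub> s) x - lmul r x \<otimes>\<^bsub>F\<^esub> lmul s x \<in> K"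
      using keys
    proof (induction x rule: frag_induction)
      case (diff x y)
      then have "(lmul (r \<oplus>\<^bsub>R\<^esub> s) x - lmul r x \<otimes>\<^bsub>F\<^esub> lmul s x) - (lmul (r \<oplus>\<^bsub>R\<^esub> s) y - lmul r y \<otimes>\<^bsub>F\<^esub> lmul s y) \<in> K"
        by (rule kernel_closed(3))
      then show ?case by (simp add: frag_extend_diff algebra_simps)
    next
      case (one p)
      then obtain u n where "p = (u, n)" "u \<in> carrier R" "n \<in> carrier N" by auto
      then show ?case using r s kernel_add_left[of "r \<otimes>\<^bsub>R\<^esub> u" "s \<otimes>\<^bsub>R\<^esub> u" n]
        by (simp add: R.l_distr)
    qed (use kernel_closed in simp)
  qed
  have assoc: "lmul (r \<otimes>\<^bsub>R\<^esub> s) x = lmul r (lmul s x)"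
    if r: "r \<in> carrier R" and s: "s \<in> carrier R" and x: "x \<in> carrier F" for r s x
  proof -
    have keys: "Poly_Mapping.keys x \<subseteq> S" using x by simp
    then show ?thesis
      by (induction x rule: frag_induction) (auto simp: frag_extend_diff R.m_assoc r s)
  qed
  have one: "lmul \<one>\<^bsub>R\<^esub> x = x" if x: "x \<in> carrier F" for x
  proof -
    have keys: "Poly_Mapping.keys x \<subseteq> S" using x by simp
    then show ?thesis
      by (induction x rule: frag_induction) (auto simp: frag_extend_diff)
  qed
  note * = quotient_left_module[of R F K lmul, OF R.ring_axioms abelian_free_Abelian_group kernel_subgroup
      hom lmul_kernel distr]
  show "left_module R T"
    using *(1) unfolding tensor_module_def Let_def by (simp add: assoc one)
  show "r \<odot>\<^bsub>T\<^esub> (K #>\<^bsub>F\<^esub> x) = K #>\<^bsub>F\<^esub> lmul r x" if "r \<in> carrier R" "Poly_Mapping.keys x \<subseteq> S"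
    using *(2) that unfolding tensor_module_def Let_def by (simp add: assoc one)
  show "(K #>\<^bsub>F\<^esub> x) \<oplus>\<^bsub>T\<^esub> (K #>\<^bsub>F\<^esub> y) = K #>\<^bsub>F\<^esub> (x + y)" if "Poly_Mapping.keys x \<subseteq> S" "Poly_Mapping.keys y \<subseteq> S"
    using *(3) that unfolding tensor_module_def Let_def by (simp add: assoc one)
qed

end

text \<open>The additive extension of \<open>f\<close> to the free abelian group. The constant \<open>frag_extend\<close> takes values in
  free abelian groups only; here the target is the additive group of a ring.\<close>

definition frag_sum :: "('k \<Rightarrow> 'v::ring_1) \<Rightarrow> ('k \<Rightarrow>\<^sub>0 int) \<Rightarrow> 'v" where
  "frag_sum f x = (\<Sum>k\<in>Poly_Mapping.keys x. of_int (Poly_Mapping.lookup x k) * f k)"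

lemma frag_sum_of [simp]: "frag_sum f (frag_of k) = f k"
  by (simp add: frag_sum_def keys_frag_of)

lemma frag_sum_zero [simp]: "frag_sum f 0 = 0"
  by (simp add: frag_sum_def)

lemma frag_sum_diff: "frag_sum f (x - y) = frag_sum f x - frag_sum f y"
proof -
  let ?A = "Poly_Mapping.keys x \<union> Poly_Mapping.keys y"
  have "frag_sum f z = (\<Sum>k\<in>?A. of_int (Poly_Mapping.lookup z k) * f k)" if "Poly_Mapping.keys z \<subseteq> ?A" for z
    unfolding frag_sum_def using that
    by (intro sum.mono_neutral_left) (auto simp: in_keys_iff)
  then show ?thesis
    using keys_diff[of x y] by (simp add: lookup_minus left_diff_distrib sum_subtractf)
qed

lemma frag_sum_add: "frag_sum f (x + y) = frag_sum f x + frag_sum f y"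
  using frag_sum_diff[of f "x + y" y] by simp

text \<open>The universal property of the tensor product: balanced biadditive maps factor through it.\<close>

lemma (in tensor_product) frag_sum_kernel:
  assumes "\<And>u v n. u \<in> carrier R \<Longrightarrow> v \<in> carrier R \<Longrightarrow> n \<in> carrier N \<Longrightarrow> f (u \<oplus>\<^bsub>R\<^esub> v, n) = f (u, n) + f (v, n)"
    and "\<And>u m n. u \<in> carrier R \<Longrightarrow> m \<in> carrier N \<Longrightarrow> n \<in> carrier N \<Longrightarrow> f (u, m \<oplus>\<^bsub>N\<^esub> n) = f (u, m) + f (u, n)"
    and "\<And>u a n. u \<in> carrier R \<Longrightarrow> a \<in> carrier A \<Longrightarrow> n \<in> carrier N \<Longrightarrow> f (u \<otimes>\<^bsub>R\<^esub> j a, n) = f (u, a \<odot>\<^bsub>N\<^esub> n)"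
    and "x \<in> K"
  shows "frag_sum f x = 0"
  using assms(4)
proof (induction rule: kernel_induct)
  case (relation x)
  then show ?case
    unfolding tensor_relations_def using assms(1-3) by (auto simp: frag_sum_diff frag_sum_add)
qed (simp_all add: frag_sum_diff)

section \<open>The action of SL(2) on the Schroedinger algebra\<close>

text \<open>The images of \<open>p\<close> and \<open>q\<close> are \<open>p' = c p + d q\<close> and \<open>q' = a q - b p\<close>. The images \<open>e'\<close> and \<open>f'\<close>
  are the elements of sl(2) with \<open>[e', p'] = 0\<close>, \<open>[e', q'] = p'\<close> and \<open>[f', p'] = q'\<close>,
  \<open>[f', q'] = 0\<close>, and \<open>h' = [e', f']\<close>. For \<open>a = \<phi> p\<close> and \<open>b = \<phi> q\<close> the element \<open>f'\<close> is \<open>C\<close>.\<close>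

definition twist :: "complex \<Rightarrow> complex \<Rightarrow> complex \<Rightarrow> complex \<Rightarrow> schrodinger \<Rightarrow> schrodinger" where
  "twist a b c d x =
     x $ BE *s (c\<^sup>2 *s sch_e - (c * d) *s sch_h - d\<^sup>2 *s sch_f)
   + x $ BH *s ((2 * b * c) *s sch_e + (a * c - b * d) *s sch_h + (2 * a * d) *s sch_f)
   + x $ BF *s (a\<^sup>2 *s sch_f - b\<^sup>2 *s sch_e - (a * b) *s sch_h)
   + x $ BP *s (c *s sch_p + d *s sch_q) + x $ BQ *s (a *s sch_q - b *s sch_p) + x $ BZ *s sch_z"

lemma twist_nth:
  "twist a b c d x $ BE = x $ BE * c\<^sup>2 + 2 * x $ BH * b * c - x $ BF * b\<^sup>2"
  "twist a b c d x $ BH = - x $ BE * c * d + x $ BH * (a * c - b * d) - x $ BF * a * b"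
  "twist a b c d x $ BF = - x $ BE * d\<^sup>2 + 2 * x $ BH * a * d + x $ BF * a\<^sup>2"
  "twist a b c d x $ BP = x $ BP * c - x $ BQ * b"
  "twist a b c d x $ BQ = x $ BP * d + x $ BQ * a"
  "twist a b c d x $ BZ = x $ BZ"
  by (simp_all add: twist_def sch_basis_defs axis_def algebra_simps)

lemma twist_bracket:
  assumes "a * c + b * d = 1"
  shows "sch_bracket (twist a b c d x) (twist a b c d y) = twist a b c d (sch_bracket x y)"
proof -
  \<comment> \<open>Without the condition on the determinant this is an identity of polynomials in all coordinates.\<close>
  have "sch_bracket (twist a b c d x) (twist a b c d y) = (a * c + b * d) *s twist a b c d (sch_bracket x y)"
    unfolding vec_eq_iff all_sbasis
    by (simp add: sch_bracket_nth twist_nth power2_eq_square algebra_simps)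
  then show ?thesis using assms by simp
qed

text \<open>The coordinates of \<open>p'\<close> and \<open>q'\<close> form the matrix with rows \<open>(c, d)\<close> and \<open>(-b, a)\<close>; its inverse
  has rows \<open>(a, -d)\<close> and \<open>(b, c)\<close>.\<close>

lemma twist_inverse:
  assumes "a * c + b * d = 1"
  shows "twist a b c d (twist c (- b) a (- d) x) = x"
proof -
  define y where "y = twist a b c d (twist c (- b) a (- d) x)"
  have "y $ BE = (a * c + b * d)\<^sup>2 * x $ BE" "y $ BH = (a * c + b * d)\<^sup>2 * x $ BH"
    "y $ BF = (a * c + b * d)\<^sup>2 * x $ BF" "y $ BP = (a * c + b * d) * x $ BP"
    "y $ BQ = (a * c + b * d) * x $ BQ" "y $ BZ = x $ BZ"
    by (simp_all add: y_def twist_nth power2_eq_square algebra_simps)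
  then show ?thesis unfolding y_def[symmetric] using assms by (simp add: vec_eq_iff all_sbasis)
qed

lemma twist_linear:
  "twist a b c d (x + y) = twist a b c d x + twist a b c d y"
  "twist a b c d (k *s x) = k *s twist a b c d x"
  unfolding vec_eq_iff all_sbasis by (simp_all add: twist_nth algebra_simps)

section \<open>A polynomial model of the simple quotient\<close>

definition shift :: "complex \<Rightarrow> complex poly \<Rightarrow> complex poly" where
  "shift m g = pcompose g [:m, 1:]"

lemma shift_simps [simp]:
  "shift m 0 = 0" "shift m (g + g') = shift m g + shift m g'" "shift m (g - g') = shift m g - shift m g'"
  "shift m (- g) = - shift m g"
  "shift m (smult c g) = smult c (shift m g)" "shift m (pCons c g) = [:c:] + [:m, 1:] * shift m g"
  "shift m [:c:] = [:c:]"
  by (simp_all add: shift_def pcompose_add pcompose_diff pcompose_uminus pcompose_smult pcompose_pCons)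

lemma shift_shift [simp]: "shift m (shift n g) = shift (m + n) g"
  by (simp add: shift_def pcompose_pCons flip: pcompose_assoc) (simp add: add.commute)

text \<open>The outer variable is \<open>t\<close> and the coefficients are polynomials in \<open>s\<close>. The monomial \<open>t^i s^j\<close>
  stands for \<open>e^i h^j w\<close>, where \<open>w\<close> is a vector with \<open>p w = w\<close>, \<open>q w = 0\<close>, \<open>z w = 0\<close>
  and \<open>f w = \<xi> w\<close>.\<close>

type_synonym model = "complex poly poly"

text \<open>Each generator is moved to the right past \<open>e^i\<close> and then past \<open>g(h)\<close>, where the rule is
  \<open>x g(h) = g(h + m) x\<close> for \<open>x\<close> of weight \<open>-m\<close>, until it meets \<open>w\<close>. The lower order terms for \<open>f\<close>
  come from \<open>e^i f - f e^i = i e^(i-1) (h + i - 1)\<close>, those for \<open>q\<close> from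
  \<open>e^i q - q e^i = i e^(i-1) p\<close>.\<close>

fun wh_op :: "complex \<Rightarrow> sbasis \<Rightarrow> model \<Rightarrow> model" where
  "wh_op \<xi> BE G = pCons 0 G"
| "wh_op \<xi> BH G = smult [:0, 1:] G + smult 2 (pCons 0 (pderiv G))"
| "wh_op \<xi> BP G = map_poly (shift (-1)) G"
| "wh_op \<xi> BQ G = - pderiv (map_poly (shift (-1)) G)"
| "wh_op \<xi> BF G = smult [:\<xi>:] (map_poly (shift 2) G)
     - (smult [:0, 1:] (pderiv G) + pCons 0 (pderiv (pderiv G)))"
| "wh_op \<xi> BZ G = 0"

lemma smult_two: "smult 2 G = G + G" for G :: "'a::comm_ring_1 poly"
  using smult_add_left[of 1 1 G] by simp

lemma two_times_pCons: "2 * pCons a G = pCons (2 * a) (2 * G)" for a :: "'a::comm_ring_1"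
  unfolding mult_2 by simp

text \<open>The effect on \<open>g + t G\<close>, which commutes a generator past a single factor \<open>e\<close>. In this recursive
  form the operators are compared with the commutation relations, here and in the enveloping
  algebra.\<close>

lemma wh_op_pCons:
  "wh_op \<xi> BE (pCons g G) = pCons 0 (pCons g G)"
  "wh_op \<xi> BH (pCons g G) = pCons (pCons 0 g) (wh_op \<xi> BH G + smult 2 G)"
  "wh_op \<xi> BP (pCons g G) = pCons (shift (-1) g) (wh_op \<xi> BP G)"
  "wh_op \<xi> BQ (pCons g G) = pCons 0 (wh_op \<xi> BQ G) - wh_op \<xi> BP G"
  "wh_op \<xi> BF (pCons g G) = pCons (smult \<xi> (shift 2 g)) (wh_op \<xi> BF G) - wh_op \<xi> BH G"
  by (simp_all add: map_poly_pCons pderiv_pCons pderiv_add smult_add_right smult_two)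

lemma wh_op_zero [simp]: "wh_op \<xi> i 0 = 0"
  by (cases i) simp_all

lemma map_poly_shift:
  "map_poly (shift m) (G + G') = map_poly (shift m) G + map_poly (shift m) G'"
  "map_poly (shift m) (smult [:c:] G) = smult [:c:] (map_poly (shift m) G)"
  by (rule poly_eqI; simp add: coeff_map_poly)+

lemma wh_op_add: "wh_op \<xi> i (G + G') = wh_op \<xi> i G + wh_op \<xi> i G'"
  by (cases i) (simp_all add: map_poly_shift pderiv_add smult_add_right)

lemma wh_op_smult: "wh_op \<xi> i (smult [:c:] G) = smult [:c:] (wh_op \<xi> i G)"
  by (cases i) (simp_all add: map_poly_shift pderiv_smult smult_add_right smult_diff_right mult.commute)

lemma wh_op_minus: "wh_op \<xi> i (- G) = - wh_op \<xi> i G"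
proof -
  have "[:-1:] = (-1 :: complex poly)" by (simp add: one_pCons)
  then show ?thesis using wh_op_smult[of \<xi> i "-1" G] by simp
qed

lemma wh_op_double: "wh_op \<xi> i (2 * G) = 2 * wh_op \<xi> i G"
  unfolding mult_2 by (rule wh_op_add)

lemma wh_op_diff: "wh_op \<xi> i (G - G') = wh_op \<xi> i G - wh_op \<xi> i G'"
  using wh_op_add[of \<xi> i G "- G'"] by (simp add: wh_op_minus)

text \<open>One of the two operators is multiplication by \<open>t\<close>, so the recursion gives these brackets directly.\<close>

lemma wh_op_brackets:
  shows "wh_op \<xi> BH (wh_op \<xi> BE G) = wh_op \<xi> BE (wh_op \<xi> BH G) + smult 2 (wh_op \<xi> BE G)"
    and "wh_op \<xi> BE (wh_op \<xi> BF G) = wh_op \<xi> BF (wh_op \<xi> BE G) + wh_op \<xi> BH G"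
    and "wh_op \<xi> BE (wh_op \<xi> BQ G) = wh_op \<xi> BQ (wh_op \<xi> BE G) + wh_op \<xi> BP G"
    and "wh_op \<xi> BE (wh_op \<xi> BP G) = wh_op \<xi> BP (wh_op \<xi> BE G)"
  by (simp_all add: wh_op_pCons(2-) del: wh_op.simps(2-))

text \<open>The other brackets follow by induction on the degree in \<open>t\<close>; each uses those before it that
  the lower order terms in the recursion bring in.\<close>

lemma wh_op_bracket_HP: "wh_op \<xi> BH (wh_op \<xi> BP G) = wh_op \<xi> BP (wh_op \<xi> BH G) + wh_op \<xi> BP G"
  by (induction G) (simp_all add: wh_op_pCons wh_op_add wh_op_diff wh_op_double two_times_pCons smult_two del: wh_op.simps mult_pCons_right)

lemma wh_op_bracket_PQ: "wh_op \<xi> BP (wh_op \<xi> BQ G) = wh_op \<xi> BQ (wh_op \<xi> BP G)"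
  by (induction G) (simp_all add: wh_op_pCons wh_op_add wh_op_diff wh_op_double two_times_pCons smult_two del: wh_op.simps mult_pCons_right)

lemma wh_op_bracket_HQ: "wh_op \<xi> BH (wh_op \<xi> BQ G) = wh_op \<xi> BQ (wh_op \<xi> BH G) - wh_op \<xi> BQ G"
  by (induction G) (simp_all add: wh_op_pCons wh_op_add wh_op_diff wh_op_double two_times_pCons smult_two wh_op_bracket_HP del: wh_op.simps mult_pCons_right)

lemma wh_op_bracket_HF: "wh_op \<xi> BH (wh_op \<xi> BF G) = wh_op \<xi> BF (wh_op \<xi> BH G) - smult 2 (wh_op \<xi> BF G)"
  by (induction G) (simp_all add: wh_op_pCons wh_op_add wh_op_diff wh_op_double two_times_pCons smult_two smult_add_right del: wh_op.simps mult_pCons_right)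

lemma wh_op_bracket_PF: "wh_op \<xi> BP (wh_op \<xi> BF G) = wh_op \<xi> BF (wh_op \<xi> BP G) - wh_op \<xi> BQ G"
  by (induction G) (simp_all add: wh_op_pCons wh_op_add wh_op_diff wh_op_double two_times_pCons smult_two wh_op_bracket_HP del: wh_op.simps mult_pCons_right)

lemma wh_op_bracket_FQ: "wh_op \<xi> BF (wh_op \<xi> BQ G) = wh_op \<xi> BQ (wh_op \<xi> BF G)"
  by (induction G) (simp_all add: wh_op_pCons wh_op_add wh_op_diff wh_op_double two_times_pCons smult_two wh_op_bracket_HQ wh_op_bracket_PF del: wh_op.simps mult_pCons_right)

lemma smult_sum_right: "smult c (\<Sum>k\<in>A. f k) = (\<Sum>k\<in>A. smult c (f k))"
  for f :: "'b \<Rightarrow> 'a::comm_ring_1 poly"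
  by (induction A rule: infinite_finite_induct) (simp_all add: smult_add_right)

lemma const_poly_add: "smult [:a + b:] G = smult [:a:] G + smult [:b:] G" for G :: model
  by (simp flip: smult_add_left)

lemma const_poly: "[:1:] = (1 :: complex poly)" "[:-1:] = (-1 :: complex poly)"
   "[:2:] = (2 :: complex poly)" "[:-2:] = (-2 :: complex poly)"
  by (simp_all add: one_pCons numeral_poly)

lemma wh_op_commutator:
  "wh_op \<xi> i (wh_op \<xi> j G) - wh_op \<xi> j (wh_op \<xi> i G)
     = (\<Sum>k\<in>UNIV. smult [:(sch_table i j - sch_table j i) $ k:] (wh_op \<xi> k G))"
  using wh_op_brackets[of \<xi> G] wh_op_bracket_HP[of \<xi> G] wh_op_bracket_HQ[of \<xi> G]
    wh_op_bracket_HF[of \<xi> G] wh_op_bracket_PQ[of \<xi> G] wh_op_bracket_PF[of \<xi> G]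
    wh_op_bracket_FQ[of \<xi> G]
  by (cases i; cases j) (simp_all add: UNIV_sbasis sch_basis_defs axis_def const_poly smult_two del: wh_op.simps(1-5) flip: one_pCons)

definition wh_rep :: "complex \<Rightarrow> schrodinger \<Rightarrow> model \<Rightarrow> model" where
  "wh_rep \<xi> x G = (\<Sum>i\<in>UNIV. smult [:x $ i:] (wh_op \<xi> i G))"

lemma wh_rep_add_left: "wh_rep \<xi> (x + y) G = wh_rep \<xi> x G + wh_rep \<xi> y G"
  by (simp add: wh_rep_def sum.distrib const_poly_add)

lemma wh_rep_scale_left: "wh_rep \<xi> (c *s x) G = smult [:c:] (wh_rep \<xi> x G)"
  by (simp add: wh_rep_def smult_sum_right mult.commute)

lemma wh_rep_add: "wh_rep \<xi> x (G + G') = wh_rep \<xi> x G + wh_rep \<xi> x G'"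
  by (simp add: wh_rep_def sum.distrib smult_add_right wh_op_add)

lemma wh_rep_smult: "wh_rep \<xi> x (smult [:c:] G) = smult [:c:] (wh_rep \<xi> x G)"
proof -
  have "smult [:x $ i:] (wh_op \<xi> i (smult [:c:] G)) = smult [:c:] (smult [:x $ i:] (wh_op \<xi> i G))" for i
    by (simp add: wh_op_smult mult.commute)
  then show ?thesis by (simp add: wh_rep_def smult_sum_right)
qed

lemma wh_op_sum: "finite A \<Longrightarrow> wh_op \<xi> i (\<Sum>k\<in>A. f k) = (\<Sum>k\<in>A. wh_op \<xi> i (f k))"
  by (induction A rule: finite_induct) (simp_all add: wh_op_add)

lemma wh_rep_axis [simp]: "wh_rep \<xi> (axis i 1) G = wh_op \<xi> i G"
  by (simp add: wh_rep_def axis_def if_distrib[of "\<lambda>c. smult [:c:] _"] const_poly cong: if_cong)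

lemma wh_rep_sum_left: "finite A \<Longrightarrow> wh_rep \<xi> (\<Sum>k\<in>A. f k) G = (\<Sum>k\<in>A. wh_rep \<xi> (f k) G)"
  by (induction A rule: finite_induct) (simp_all add: wh_rep_add_left, simp add: wh_rep_def)

text \<open>By bilinearity of both sides, the table of brackets of basis vectors suffices.\<close>

lemma wh_rep_bracket:
  "wh_rep \<xi> x (wh_rep \<xi> y G) - wh_rep \<xi> y (wh_rep \<xi> x G) = wh_rep \<xi> (sch_bracket x y) G"
proof -
  have "wh_rep \<xi> x (wh_rep \<xi> y G) = (\<Sum>i\<in>UNIV. \<Sum>j\<in>UNIV. smult [:x $ i * y $ j:] (wh_op \<xi> i (wh_op \<xi> j G)))" for x y
    by (simp add: wh_rep_def wh_op_sum wh_op_smult smult_sum_right mult.commute[of "y $ j" "x $ i" for i j])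
  note e = this
  have "wh_rep \<xi> y (wh_rep \<xi> x G) = (\<Sum>i\<in>UNIV. \<Sum>j\<in>UNIV. smult [:x $ i * y $ j:] (wh_op \<xi> j (wh_op \<xi> i G)))"
    unfolding e by (subst sum.swap) (simp add: mult.commute)
  then have "wh_rep \<xi> x (wh_rep \<xi> y G) - wh_rep \<xi> y (wh_rep \<xi> x G)
    = (\<Sum>i\<in>UNIV. \<Sum>j\<in>UNIV. smult [:x $ i * y $ j:] (wh_op \<xi> i (wh_op \<xi> j G) - wh_op \<xi> j (wh_op \<xi> i G)))"
    by (simp add: e smult_diff_right sum_subtractf)
  also have "\<dots> = (\<Sum>i\<in>UNIV. \<Sum>j\<in>UNIV. smult [:x $ i * y $ j:] (wh_rep \<xi> (sch_table i j - sch_table j i) G))"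
    by (simp only: wh_op_commutator wh_rep_def)
  also have "\<dots> = wh_rep \<xi> (sch_bracket x y) G"
    by (simp add: sch_bracket_def wh_rep_sum_left wh_rep_scale_left)
  finally show ?thesis .
qed

section \<open>The free algebra acting on the model\<close>

lemma fa_const_zero [simp]: "fa_const 0 = 0"
  and fa_const_one: "fa_const 1 = 1"
  and fa_const_add: "fa_const (c + c') = fa_const c + fa_const c'"
  and fa_const_mult: "fa_const (c * c') = fa_const c * fa_const c'"
  by (simp_all add: fa_const_def single_add mult_single)

lemma fa_const_single: "fa_const c * Poly_Mapping.single w k = Poly_Mapping.single w (c * k)"
  "Poly_Mapping.single w k * fa_const c = Poly_Mapping.single w (c * k)"
  by (simp_all add: fa_const_def mult_single mult.commute)

lemma fa_const_central: "a * fa_const c = fa_const c * a"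
  by (induction a rule: poly_mapping_add_single_induct) (simp_all add: distrib_left distrib_right fa_const_single)

locale twisted_model =
  fixes a b c d \<xi> :: complex
  assumes det: "a * c + b * d = 1"
begin

text \<open>The model is built in the twisted basis; the coordinates of \<open>x\<close> in that basis are the
  standard coordinates of its image under the inverse twist.\<close>

definition rho :: "schrodinger \<Rightarrow> model \<Rightarrow> model" where
  "rho x = wh_rep \<xi> (twist c (- b) a (- d) x)"

lemma rho_add: "rho x (G + G') = rho x G + rho x G'"
  and rho_smult: "rho x (smult [:k:] G) = smult [:k:] (rho x G)"
  and rho_add_left: "rho (x + y) G = rho x G + rho y G"
  and rho_scale_left: "rho (k *s x) G = smult [:k:] (rho x G)"
  by (simp_all add: rho_def wh_rep_add wh_rep_smult twist_linear wh_rep_add_left wh_rep_scale_left)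

lemma rho_bracket: "rho x (rho y G) - rho y (rho x G) = rho (sch_bracket x y) G"
  using det by (simp add: rho_def wh_rep_bracket twist_bracket mult.commute)

lemma rho_twist: "rho (twist a b c d x) G = wh_rep \<xi> x G"
  using twist_inverse[of c a "-b" "-d" x] det by (simp add: rho_def mult.commute)

definition act :: "schrodinger free_alg \<Rightarrow> model \<Rightarrow> model" where
  "act u G = (\<Sum>w\<in>Poly_Mapping.keys u. smult [:Poly_Mapping.lookup u w:] (foldr rho (letters w) G))"

lemma act_superset:
  assumes "finite A" "Poly_Mapping.keys u \<subseteq> A"
  shows "act u G = (\<Sum>w\<in>A. smult [:Poly_Mapping.lookup u w:] (foldr rho (letters w) G))"
  unfolding act_def using assms
  by (intro sum.mono_neutral_left) (auto simp: in_keys_iff)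

lemma act_add: "act (u + v) G = act u G + act v G"
proof -
  let ?A = "Poly_Mapping.keys u \<union> Poly_Mapping.keys v"
  show ?thesis
    using keys_add[of u v]
    by (simp add: act_superset[of ?A] lookup_add const_poly_add sum.distrib)
qed

lemma act_zero [simp]: "act 0 G = 0" by (simp add: act_def)

lemma act_minus: "act (u - v) G = act u G - act v G"
  using act_add[of "u - v" v G] by simp

lemma act_single: "act (Poly_Mapping.single w k) G = smult [:k:] (foldr rho (letters w) G)"
  by (simp add: act_def)

lemma act_var [simp]: "act (fa_var x) G = rho x G"
  and act_const [simp]: "act (fa_const k) G = smult [:k:] G"
  and act_one [simp]: "act 1 G = G"
  using act_single[of 0 1 G]
  by (simp_all add: fa_var_def fa_const_def act_single zero_free_monoid_def const_poly flip: single_one)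

lemma foldr_rho_linear:
  "foldr rho xs (G + G') = foldr rho xs G + foldr rho xs G'"
  "foldr rho xs (smult [:k:] G) = smult [:k:] (foldr rho xs G)"
  by (induction xs) (simp_all add: rho_add rho_smult)

lemma act_add_right: "act u (G + G') = act u G + act u G'"
  by (induction u rule: poly_mapping_add_single_induct)
     (simp_all add: act_add act_single foldr_rho_linear smult_add_right)

lemma act_zero_right [simp]: "act u 0 = 0"
  using act_add_right[of u 0 0] by simp

lemma act_smult: "act u (smult [:k:] G) = smult [:k:] (act u G)"
  by (induction u rule: poly_mapping_add_single_induct)
     (simp_all add: act_add act_single foldr_rho_linear smult_add_right mult.commute)

lemma act_mult: "act (u * v) G = act u (act v G)"
proof (induction u rule: poly_mapping_add_single_induct)
  case (2 u w k)
  have "act (Poly_Mapping.single w k * v) G = act (Poly_Mapping.single w k) (act v G)"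
  proof (induction v rule: poly_mapping_add_single_induct)
    case (2 v w' k')
    then show ?case
      by (simp add: distrib_left act_add act_add_right mult_single act_single plus_free_monoid_def foldr_rho_linear mult.commute)
  qed simp
  with 2 show ?case by (simp add: distrib_right act_add)
qed simp

text \<open>The elements acting by zero form a two-sided ideal, and it contains the defining relations since \<open>rho\<close> is a representation.\<close>

lemma act_ideal:
  assumes "u \<in> uea_ideal UNIV"
  shows "act u G = 0"
proof -
  interpret R: ring "free_algebra UNIV :: schrodinger free_alg ring" by (rule free_algebra_ring)
  let ?A = "free_algebra UNIV :: schrodinger free_alg ring"
  let ?K = "{u \<in> carrier ?A. \<forall>G. act u G = 0}"
  have all: "x \<in> carrier ?A" for x :: "schrodinger free_alg" by (simp add: carrier_free_algebra)
  have neg: "\<ominus>\<^bsub>?A\<^esub> x = - x" for x :: "schrodinger free_alg"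
    by (rule R.minus_equality) (auto simp: free_algebra_simps all)
  have "ideal ?K ?A"
  proof (rule idealI[OF free_algebra_ring])
    show "subgroup ?K (add_monoid ?A)"
    proof (rule group.subgroupI)
      show "group (add_monoid ?A)" by (rule R.add.is_group)
      show "?K \<noteq> {}" by (auto intro!: exI[of _ 0] simp: all)
      fix x assume x: "x \<in> ?K"
      have "act (- x) G = 0" for G using act_minus[of 0 x G] x by simp
      with neg[of x] show "inv\<^bsub>add_monoid ?A\<^esub> x \<in> ?K"
        by (simp add: a_inv_def all)
    qed (auto simp: free_algebra_simps act_add all)
  qed (auto simp: free_algebra_simps act_mult all)
  moreover have "uea_relations UNIV \<subseteq> ?K"
    by (auto simp: uea_relations_def act_minus act_add act_mult all rho_add_left rho_scale_left rho_bracket)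
  ultimately have "uea_ideal UNIV \<subseteq> ?K"
    unfolding uea_ideal_def by (rule R.genideal_minimal)
  with assms show ?thesis by auto
qed

definition gen :: "sbasis \<Rightarrow> schrodinger free_alg" where
  "gen i = fa_var (twist a b c d (axis i 1))"

lemma act_gen: "act (gen i) G = wh_op \<xi> i G"
  by (simp add: gen_def rho_twist)

end

section \<open>Irreducibility of the model\<close>

text \<open>The leading terms cancel. If the difference were zero, then \<open>g\<close> would take the value \<open>g(0)\<close>
  at every negative integer.\<close>

lemma shift_difference:
  assumes "degree g > 0"
  shows "shift (-1) g - g \<noteq> 0" "degree (shift (-1) g - g) < degree g"
proof -
  let ?d = "shift (-1) g - g"
  have deg: "degree (shift (-1) g) = degree g" by (simp add: shift_def degree_pcompose)
  have "coeff (shift (-1) g) (degree g) = lead_coeff g"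
    using lead_coeff_comp[of "[:-1, 1:]" g] deg by (simp add: shift_def)
  then have "coeff ?d (degree g) = 0" by simp
  moreover have "degree ?d \<le> degree g" using degree_diff_le[of "shift (-1) g" "degree g" g] deg by simp
  ultimately show "degree ?d < degree g"
    using assms by (metis degree_0 le_neq_implies_less leading_coeff_0_iff)
  show "?d \<noteq> 0"
  proof
    assume "?d = 0"
    then have "poly (shift (-1) g) x = poly g x" for x by simp
    then have step: "poly g (x - 1) = poly g x" for x by (simp add: shift_def poly_pcompose)
    have "poly g (- of_nat n) = poly g 0" for n
    proof (induction n)
      case (Suc n)
      have "- of_nat (Suc n) = (- of_nat n - 1 :: complex)" by simp
      then show ?case using Suc step by metis
    qed simp
    then have "range (\<lambda>n. - of_nat n :: complex) \<subseteq> {x. poly (g - [:poly g 0:]) x = 0}" by auto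
    moreover have "infinite (range (\<lambda>n. - of_nat n :: complex))"
      by (rule range_inj_infinite) (simp add: inj_on_def)
    ultimately have "g - [:poly g 0:] = 0" using poly_roots_finite finite_subset by blast
    then have "g = [:poly g 0:]" by simp
    then have "degree g = 0" by (metis degree_pCons_0)
    with assms show False by simp
  qed
qed

context twisted_model
begin

text \<open>On polynomials in \<open>s\<close> alone, \<open>p - 1\<close> acts as a difference operator and lowers the degree by steps down to a constant.\<close>

lemma act_transitive_const:
  assumes "g \<noteq> 0"
  shows "\<exists>u. act u [:g:] = 1"
  using assms
proof (induction "degree g" arbitrary: g rule: less_induct)
  case less
  show ?case
  proof (cases "degree g = 0")
    case True
    then obtain k where k: "g = [:k:]" by (metis degree_eq_zeroE)
    with less.prems have "act (fa_const (1 / k)) [:g:] = 1" by (simp add: one_pCons)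
    then show ?thesis by blast
  next
    case False
    then obtain u where u: "act u [:shift (-1) g - g:] = 1"
      using less.hyps shift_difference[of g] by blast
    have "act (gen BP - 1) [:g:] = [:shift (-1) g - g:]"
      by (simp add: act_minus act_gen map_poly_pCons)
    with u have "act (u * (gen BP - 1)) [:g:] = 1" by (simp add: act_mult)
    then show ?thesis by blast
  qed
qed

text \<open>The operator \<open>q\<close> is a derivative in \<open>t\<close> composed with an invertible shift of \<open>s\<close>, hence lowers the \<open>t\<close>-degree to zero.\<close>

lemma act_transitive:
  assumes "G \<noteq> 0"
  shows "\<exists>u. act u G = 1"
  using assms
proof (induction "degree G" arbitrary: G rule: less_induct)
  case less
  show ?case
  proof (cases "degree G = 0")
    case True
    then obtain g where "G = [:g:]" by (metis degree_eq_zeroE)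
    with act_transitive_const less.prems show ?thesis by auto
  next
    case False
    let ?S = "map_poly (shift (-1)) G"
    have inj: "shift (-1) g = 0 \<longleftrightarrow> g = 0" for g using shift_shift[of 1 "-1" g] by (metis shift_simps(1) shift_shift add.right_inverse shift_def pcompose_idR)
    have deg: "degree ?S = degree G" by (rule map_poly_degree_eq) (use less.prems in \<open>simp add: inj\<close>)
    have "degree (pderiv ?S) < degree G" "pderiv ?S \<noteq> 0"
      using False by (simp_all add: degree_pderiv deg pderiv_eq_0_iff)
    then obtain u where u: "act u (wh_op \<xi> BQ G) = 1"
      using less.hyps[of "wh_op \<xi> BQ G"] by auto
    then have "act (u * gen BQ) G = 1" by (simp only: act_mult act_gen)
    then show ?thesis by blast
  qed
qed

end

section \<open>Relations in the enveloping algebra\<close>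

lemma
  fixes u v :: "schrodinger free_alg"
  defines "I \<equiv> uea_ideal UNIV"
  shows uea_ideal_zero: "0 \<in> I"
    and uea_ideal_add: "u \<in> I \<Longrightarrow> v \<in> I \<Longrightarrow> u + v \<in> I"
    and uea_ideal_left: "u \<in> I \<Longrightarrow> v * u \<in> I"
    and uea_ideal_right: "u \<in> I \<Longrightarrow> u * v \<in> I"
proof -
  interpret ideal I "free_algebra UNIV" unfolding I_def by (rule uea_ideal[OF UNIV_lie_subalgebra])
  have all: "x \<in> carrier (free_algebra UNIV)" for x :: "schrodinger free_alg" by (simp add: carrier_free_algebra)
  show "0 \<in> I" using additive_subgroup.zero_closed[OF additive_subgroup_axioms]
    by (simp add: free_algebra_simps)
  show "u + v \<in> I" if "u \<in> I" "v \<in> I"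
    using additive_subgroup.a_closed[OF additive_subgroup_axioms that] by (simp add: free_algebra_simps)
  show "v * u \<in> I" "u * v \<in> I" if "u \<in> I"
    using I_l_closed[OF that all] I_r_closed[OF that all] by (simp_all add: free_algebra_simps)
qed

lemma
  shows uea_ideal_var_add: "fa_var (x + y) - (fa_var x + fa_var y) \<in> uea_ideal UNIV"
    and uea_ideal_var_scale: "fa_var (k *s x) - fa_const k * fa_var x \<in> uea_ideal UNIV"
    and uea_ideal_var_bracket:
      "fa_var x * fa_var y - fa_var y * fa_var x - fa_var (sch_bracket x y) \<in> uea_ideal UNIV"
proof -
  interpret R: ring "free_algebra UNIV :: schrodinger free_alg ring" by (rule free_algebra_ring)
  have sub: "uea_relations UNIV \<subseteq> uea_ideal UNIV"
    unfolding uea_ideal_def by (rule R.genideal_self[OF uea_relations_closed[OF UNIV_lie_subalgebra]])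
  show "fa_var (x + y) - (fa_var x + fa_var y) \<in> uea_ideal UNIV"
    by (rule subsetD[OF sub], unfold uea_relations_def, rule UnI1, rule UnI1) blast
  show "fa_var (k *s x) - fa_const k * fa_var x \<in> uea_ideal UNIV"
    by (rule subsetD[OF sub], unfold uea_relations_def, rule UnI1, rule UnI2) blast
  show "fa_var x * fa_var y - fa_var y * fa_var x - fa_var (sch_bracket x y) \<in> uea_ideal UNIV"
    by (rule subsetD[OF sub], unfold uea_relations_def, rule UnI2) blast
qed

lemma uea_ideal_var_sum:
  assumes "finite A"
  shows "fa_var (\<Sum>i\<in>A. k i *s x i) - (\<Sum>i\<in>A. fa_const (k i) * fa_var (x i)) \<in> uea_ideal UNIV"
  using assms
proof (induction A rule: finite_induct)
  case empty
  show ?case using uea_ideal_var_scale[of 0 0] by simp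
next
  case (insert i A)
  have "fa_var (k i *s x i + (\<Sum>i\<in>A. k i *s x i)) - (fa_const (k i) * fa_var (x i) + (\<Sum>i\<in>A. fa_const (k i) * fa_var (x i)))
    = (fa_var (k i *s x i + (\<Sum>i\<in>A. k i *s x i)) - (fa_var (k i *s x i) + fa_var (\<Sum>i\<in>A. k i *s x i)))
    + ((fa_var (k i *s x i) - fa_const (k i) * fa_var (x i))
    + (fa_var (\<Sum>i\<in>A. k i *s x i) - (\<Sum>i\<in>A. fa_const (k i) * fa_var (x i))))"
    by (simp add: algebra_simps)
  also have "\<dots> \<in> uea_ideal UNIV"
    using insert.IH by (intro uea_ideal_add uea_ideal_var_add uea_ideal_var_scale)
  finally show ?case using insert.hyps by simp
qed

lemma fa_const_uminus: "fa_const (- k) = - fa_const k"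
  using fa_const_add[of k "- k"] by (simp add: eq_neg_iff_add_eq_0 add.commute)

context twisted_model
begin

lemma twist_sum: "twist a b c d x = (\<Sum>k\<in>UNIV. x $ k *s twist a b c d (axis k 1))"
  by (simp add: UNIV_sbasis twist_def axis_def vec_eq_iff all_sbasis)

lemma var_twist: "fa_var (twist a b c d x) - (\<Sum>k\<in>UNIV. fa_const (x $ k) * gen k) \<in> uea_ideal UNIV"
  unfolding gen_def by (subst twist_sum) (rule uea_ideal_var_sum, simp)

text \<open>The twist is an automorphism, so the twisted basis has the structure constants of the standard one.\<close>

lemma gen_commutator:
  "gen i * gen j - gen j * gen i - (\<Sum>k\<in>UNIV. fa_const ((sch_table i j - sch_table j i) $ k) * gen k) \<in> uea_ideal UNIV"
proof -
  have "sch_bracket (axis i 1) (axis j 1) = sch_table i j - sch_table j i"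
    by (cases i; cases j) (simp_all add: vec_eq_iff all_sbasis sch_bracket_nth sch_basis_defs axis_def)
  then have "gen i * gen j - gen j * gen i - fa_var (twist a b c d (sch_table i j - sch_table j i)) \<in> uea_ideal UNIV"
    using uea_ideal_var_bracket[of "twist a b c d (axis i 1)" "twist a b c d (axis j 1)"]
    by (simp add: gen_def twist_bracket[OF det])
  from uea_ideal_add[OF this var_twist[of "sch_table i j - sch_table j i"]] show ?thesis
    by simp
qed

text \<open>The commutators oriented as rewriting rules that move \<open>e\<close>, and then \<open>h\<close>, to the left.\<close>

lemma gen_relations:
  "gen BH * gen BE - gen BE * gen BH - fa_const 2 * gen BE \<in> uea_ideal UNIV"
  "gen BP * gen BH - (gen BH - 1) * gen BP \<in> uea_ideal UNIV"
  "gen BQ * gen BH - (gen BH + 1) * gen BQ \<in> uea_ideal UNIV"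
  "gen BF * gen BH - (gen BH + fa_const 2) * gen BF \<in> uea_ideal UNIV"
  "gen BF * gen BE - (gen BE * gen BF - gen BH) \<in> uea_ideal UNIV"
  "gen BQ * gen BE - (gen BE * gen BQ - gen BP) \<in> uea_ideal UNIV"
  "gen BP * gen BE - gen BE * gen BP \<in> uea_ideal UNIV"
  "gen BZ * gen i - gen i * gen BZ \<in> uea_ideal UNIV"
proof -
  note [simp] = UNIV_sbasis sch_basis_defs axis_def fa_const_one fa_const_uminus algebra_simps
  show "gen BH * gen BE - gen BE * gen BH - fa_const 2 * gen BE \<in> uea_ideal UNIV"
    using gen_commutator[of BH BE] by simp
  show "gen BP * gen BH - (gen BH - 1) * gen BP \<in> uea_ideal UNIV"
    using gen_commutator[of BP BH] by simp
  show "gen BQ * gen BH - (gen BH + 1) * gen BQ \<in> uea_ideal UNIV"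
    using gen_commutator[of BQ BH] by simp
  show "gen BF * gen BH - (gen BH + fa_const 2) * gen BF \<in> uea_ideal UNIV"
    using gen_commutator[of BF BH] by simp
  show "gen BF * gen BE - (gen BE * gen BF - gen BH) \<in> uea_ideal UNIV"
    using gen_commutator[of BF BE] by simp
  show "gen BQ * gen BE - (gen BE * gen BQ - gen BP) \<in> uea_ideal UNIV"
    using gen_commutator[of BQ BE] by simp
  show "gen BP * gen BE - gen BE * gen BP \<in> uea_ideal UNIV"
    using gen_commutator[of BP BE] by simp
  show "gen BZ * gen i - gen i * gen BZ \<in> uea_ideal UNIV"
    using gen_commutator[of BZ i] by (cases i) simp_all
qed

end

section \<open>Normal forms modulo the annihilator\<close>

text \<open>Powers of \<open>X\<close> stand to the left of the coefficients, so that two nested evaluations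
  produce the ordered monomials \<open>e^i h^j\<close>.\<close>

definition poly_at :: "('a::zero \<Rightarrow> 'b::ring_1) \<Rightarrow> 'b \<Rightarrow> 'a poly \<Rightarrow> 'b" where
  "poly_at \<kappa> X g = fold_coeffs (\<lambda>k r. \<kappa> k + X * r) g 0"

lemma poly_at_zero [simp]: "poly_at \<kappa> X 0 = 0"
  by (simp add: poly_at_def)

lemma poly_at_pCons: "\<kappa> 0 = 0 \<Longrightarrow> poly_at \<kappa> X (pCons k g) = \<kappa> k + X * poly_at \<kappa> X g"
  by (cases "k = 0 \<and> g = 0") (auto simp: poly_at_def)

lemma poly_at_add:
  fixes \<kappa> :: "'a::comm_monoid_add \<Rightarrow> 'b::ring_1"
  assumes "\<kappa> 0 = 0" "\<And>k l. \<kappa> (k + l) = \<kappa> k + \<kappa> l"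
  shows "poly_at \<kappa> X (g + g') = poly_at \<kappa> X g + poly_at \<kappa> X g'"
proof (induction g arbitrary: g')
  case (pCons k g)
  then show ?case
    by (cases g') (simp add: poly_at_pCons assms algebra_simps)
qed simp

lemma poly_at_smult:
  fixes \<kappa> :: "'a::comm_semiring_0 \<Rightarrow> 'b::ring_1"
  assumes "\<kappa> 0 = 0" "\<And>l. \<kappa> (k * l) = K * \<kappa> l" "X * K = K * X"
  shows "poly_at \<kappa> X (smult k g) = K * poly_at \<kappa> X g"
proof (induction g)
  case (pCons l g)
  then show ?case
    by (simp add: poly_at_pCons assms(1,2) distrib_left mult.assoc[symmetric] assms(3))
qed simp

context twisted_model
begin

definition h_poly :: "complex poly \<Rightarrow> schrodinger free_alg" where
  "h_poly = poly_at fa_const (gen BH)"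

definition eh_poly :: "model \<Rightarrow> schrodinger free_alg" where
  "eh_poly = poly_at h_poly (gen BE)"

lemma h_poly_simps:
  "h_poly 0 = 0" "h_poly (pCons k g) = fa_const k + gen BH * h_poly g"
  "h_poly (g + g') = h_poly g + h_poly g'" "h_poly (smult k g) = fa_const k * h_poly g"
  unfolding h_poly_def
  by (simp_all add: poly_at_pCons poly_at_add fa_const_add)
     (rule poly_at_smult; simp add: fa_const_mult fa_const_central[of "gen BH"])

lemma eh_poly_simps:
  "eh_poly 0 = 0" "eh_poly (pCons g G) = h_poly g + gen BE * eh_poly G"
  "eh_poly (G + G') = eh_poly G + eh_poly G'" "eh_poly (smult [:k:] G) = fa_const k * eh_poly G"
  unfolding eh_poly_def
  by (simp_all add: poly_at_pCons poly_at_add h_poly_simps)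
     (rule poly_at_smult; simp add: h_poly_simps fa_const_central[of "gen BE"])

lemma eh_poly_diff: "eh_poly (G - G') = eh_poly G - eh_poly G'"
  using eh_poly_simps(3)[of "G - G'" G'] by simp

end

text \<open>In the quotient of the free algebra by \<open>J\<close>, the class of \<open>1\<close> satisfies the relations
  that characterise \<open>w\<close>. The instance used below consists of the elements that send \<open>w\<close> into \<open>W\<close>.\<close>

locale whittaker_ideal = twisted_model +
  fixes J :: "schrodinger free_alg set"
  assumes diff: "u \<in> J \<Longrightarrow> v \<in> J \<Longrightarrow> u - v \<in> J"
    and left: "u \<in> J \<Longrightarrow> v * u \<in> J"
    and uea: "uea_ideal UNIV \<subseteq> J"
    and gen_p: "gen BP - 1 \<in> J" and gen_q: "gen BQ \<in> J" and gen_z: "gen BZ \<in> J"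
    and gen_f: "gen BF - fa_const \<xi> \<in> J"
begin

lemma zero: "0 \<in> J"
  using uea uea_ideal_zero by blast

lemma add: "u \<in> J \<Longrightarrow> v \<in> J \<Longrightarrow> u + v \<in> J"
  using diff[OF _ diff[OF zero]] by fastforce

lemma uea_right: "u \<in> uea_ideal UNIV \<Longrightarrow> u * v \<in> J"
  using uea uea_ideal_right by blast

text \<open>The hypothesis says that \<open>X\<close> has weight \<open>-m\<close>.\<close>

lemma h_poly_shift:
  assumes X: "X * gen BH - (gen BH + fa_const m) * X \<in> uea_ideal UNIV"
  shows "X * h_poly g - h_poly (shift m g) * X \<in> uea_ideal UNIV"
proof (induction g)
  case 0
  then show ?case by (simp add: h_poly_simps uea_ideal_zero)
next
  case (pCons k g)
  have "h_poly (shift m (pCons k g)) = fa_const k + (gen BH + fa_const m) * h_poly (shift m g)"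
    by (simp add: h_poly_simps algebra_simps flip: smult_add_left)
  then have "X * h_poly (pCons k g) - h_poly (shift m (pCons k g)) * X
    = (X * gen BH - (gen BH + fa_const m) * X) * h_poly g
      + (gen BH + fa_const m) * (X * h_poly g - h_poly (shift m g) * X)"
    by (simp add: h_poly_simps fa_const_central[of X] algebra_simps)
  with X pCons.IH show ?case
    by (simp only: uea_ideal_add uea_ideal_left uea_ideal_right)
qed

text \<open>After passing \<open>g(h)\<close> the factor \<open>X\<close> stands on the right, where \<open>J\<close> being a left ideal permits replacing it by a scalar.\<close>

lemma h_poly_shift_eval:
  assumes X: "X * gen BH - (gen BH + fa_const m) * X \<in> uea_ideal UNIV" and k: "X - fa_const k \<in> J"
  shows "X * h_poly g - h_poly (smult k (shift m g)) \<in> J"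
proof -
  have "X * h_poly g - h_poly (smult k (shift m g))
    = (X * h_poly g - h_poly (shift m g) * X) + h_poly (shift m g) * (X - fa_const k)"
    by (simp add: h_poly_simps fa_const_central[of "h_poly (shift m g)"] algebra_simps)
  also have "\<dots> \<in> J"
    using uea h_poly_shift[OF X] k by (intro add left) auto
  finally show ?thesis .
qed

lemma h_poly_gen_p: "gen BP * h_poly g - h_poly (shift (-1) g) \<in> J"
  using h_poly_shift_eval[of "gen BP" "-1" 1 g] gen_relations(2) gen_p
  by (simp add: fa_const_uminus fa_const_one)

lemma h_poly_gen_q: "gen BQ * h_poly g \<in> J"
  using h_poly_shift_eval[of "gen BQ" 1 0 g] gen_relations(3) gen_q
  by (simp add: fa_const_one h_poly_simps)

lemma h_poly_gen_f: "gen BF * h_poly g - h_poly (smult \<xi> (shift 2 g)) \<in> J"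
  using h_poly_shift_eval[of "gen BF" 2 \<xi> g] gen_relations(4) gen_f by simp

text \<open>Each of the next lemmas follows the recursion \<open>wh_op_pCons\<close>: the difference to be shown in
  \<open>J\<close> splits into a commutation relation multiplied by \<open>eh_poly G\<close>, a left multiple of the induction
  hypothesis, and instances of the earlier lemmas for the generators that the commutator
  creates.\<close>

lemma eh_poly_gen_h: "gen BH * eh_poly G - eh_poly (wh_op \<xi> BH G) \<in> J"
proof (induction G)
  case (pCons g G)
  have "eh_poly (smult 2 G) = fa_const 2 * eh_poly G"
    using eh_poly_simps(4)[of 2 G] by (simp add: const_poly)
  moreover have "gen BE * (fa_const 2 * u) = fa_const 2 * (gen BE * u)" for u
    by (simp add: fa_const_central[of "gen BE"] flip: mult.assoc)
  ultimately have "gen BH * eh_poly (pCons g G) - eh_poly (wh_op \<xi> BH (pCons g G))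
    = (gen BH * gen BE - gen BE * gen BH - fa_const 2 * gen BE) * eh_poly G
      + gen BE * (gen BH * eh_poly G - eh_poly (wh_op \<xi> BH G))"
    by (simp add: wh_op_pCons eh_poly_simps h_poly_simps algebra_simps del: wh_op.simps)
  also have "\<dots> \<in> J"
    by (intro add left pCons.IH uea_right gen_relations)
  finally show ?case .
qed (simp add: eh_poly_simps zero)

lemma eh_poly_gen_p: "gen BP * eh_poly G - eh_poly (wh_op \<xi> BP G) \<in> J"
proof (induction G)
  case (pCons g G)
  have "gen BP * eh_poly (pCons g G) - eh_poly (wh_op \<xi> BP (pCons g G))
    = (gen BP * h_poly g - h_poly (shift (-1) g)) + ((gen BP * gen BE - gen BE * gen BP) * eh_poly G
      + gen BE * (gen BP * eh_poly G - eh_poly (wh_op \<xi> BP G)))"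
    by (simp add: wh_op_pCons eh_poly_simps algebra_simps del: wh_op.simps)
  also have "\<dots> \<in> J"
    by (intro add left pCons.IH uea_right gen_relations h_poly_gen_p)
  finally show ?case .
qed (simp add: eh_poly_simps zero)

lemma eh_poly_gen_q: "gen BQ * eh_poly G - eh_poly (wh_op \<xi> BQ G) \<in> J"
proof (induction G)
  case (pCons g G)
  have "gen BQ * eh_poly (pCons g G) - eh_poly (wh_op \<xi> BQ (pCons g G))
    = gen BQ * h_poly g + ((gen BQ * gen BE - (gen BE * gen BQ - gen BP)) * eh_poly G
      + (gen BE * (gen BQ * eh_poly G - eh_poly (wh_op \<xi> BQ G))
      - (gen BP * eh_poly G - eh_poly (wh_op \<xi> BP G))))"
    by (simp add: wh_op_pCons eh_poly_simps eh_poly_diff h_poly_simps algebra_simps del: wh_op.simps)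
  also have "\<dots> \<in> J"
    by (intro add diff left pCons.IH uea_right gen_relations h_poly_gen_q eh_poly_gen_p)
  finally show ?case .
qed (simp add: eh_poly_simps zero)

lemma eh_poly_gen_f: "gen BF * eh_poly G - eh_poly (wh_op \<xi> BF G) \<in> J"
proof (induction G)
  case (pCons g G)
  have "gen BF * eh_poly (pCons g G) - eh_poly (wh_op \<xi> BF (pCons g G))
    = (gen BF * h_poly g - h_poly (smult \<xi> (shift 2 g)))
      + ((gen BF * gen BE - (gen BE * gen BF - gen BH)) * eh_poly G
      + (gen BE * (gen BF * eh_poly G - eh_poly (wh_op \<xi> BF G))
      - (gen BH * eh_poly G - eh_poly (wh_op \<xi> BH G))))"
    by (simp add: wh_op_pCons eh_poly_simps eh_poly_diff h_poly_simps algebra_simps del: wh_op.simps)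
  also have "\<dots> \<in> J"
    by (intro add diff left pCons.IH uea_right gen_relations h_poly_gen_f eh_poly_gen_h)
  finally show ?case .
qed (simp add: eh_poly_simps zero)

lemma eh_poly_gen_z: "gen BZ * eh_poly G \<in> J"
proof -
  have h: "gen BZ * h_poly g \<in> J" for g
    using h_poly_shift_eval[of "gen BZ" 0 0 g] gen_relations(8)[of BH] gen_z by (simp add: h_poly_simps)
  show ?thesis
  proof (induction G)
    case (pCons g G)
    have "gen BZ * eh_poly (pCons g G) = gen BZ * h_poly g
      + ((gen BZ * gen BE - gen BE * gen BZ) * eh_poly G + gen BE * (gen BZ * eh_poly G))"
      by (simp add: eh_poly_simps algebra_simps)
    also have "\<dots> \<in> J"
      by (intro add left pCons.IH uea_right gen_relations h)
    finally show ?case .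
  qed (simp add: eh_poly_simps zero)
qed

lemma eh_poly_gen: "gen i * eh_poly G - eh_poly (wh_op \<xi> i G) \<in> J"
proof (cases i)
  case BE
  then show ?thesis by (simp add: eh_poly_simps h_poly_simps zero)
next
  case BZ
  then show ?thesis using eh_poly_gen_z by (simp add: eh_poly_simps)
qed (simp_all only: eh_poly_gen_h eh_poly_gen_p eh_poly_gen_q eh_poly_gen_f)

lemma sum_mem: "(\<And>i. i \<in> A \<Longrightarrow> f i \<in> J) \<Longrightarrow> (\<Sum>i\<in>A. f i) \<in> J"
  by (induction A rule: infinite_finite_induct) (auto simp: zero add)

lemma eh_poly_sum: "eh_poly (\<Sum>i\<in>A. f i) = (\<Sum>i\<in>A. eh_poly (f i))"
  by (induction A rule: infinite_finite_induct) (auto simp: eh_poly_simps)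

lemma eh_poly_var: "fa_var x * eh_poly G - eh_poly (rho x G) \<in> J"
proof -
  define y where "y = twist c (- b) a (- d) x"
  have x: "x = twist a b c d y" unfolding y_def using twist_inverse[OF det] by simp
  have "fa_var x * eh_poly G - eh_poly (rho x G)
    = (fa_var x - (\<Sum>k\<in>UNIV. fa_const (y $ k) * gen k)) * eh_poly G
      + (\<Sum>k\<in>UNIV. fa_const (y $ k) * (gen k * eh_poly G - eh_poly (wh_op \<xi> k G)))"
    by (simp add: rho_def wh_rep_def y_def[symmetric] eh_poly_sum eh_poly_simps algebra_simps
        sum_subtractf sum_distrib_right)
  also have "\<dots> \<in> J"
    unfolding x by (intro add left uea_right var_twist sum_mem eh_poly_gen)
  finally show ?thesis .
qed

lemma eh_poly_act: "u * eh_poly G - eh_poly (act u G) \<in> J"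
proof (induction u rule: poly_mapping_add_single_induct)
  case 1
  then show ?case by (simp add: eh_poly_simps zero)
next
  case (2 u w k)
  have word: "Poly_Mapping.single (Word xs) 1 * eh_poly G - eh_poly (foldr rho xs G) \<in> J" for xs
  proof (induction xs)
    case Nil
    have "Poly_Mapping.single (Word []) 1 = (1 :: schrodinger free_alg)"
      by (simp flip: single_one zero_free_monoid_def)
    then show ?case by (simp add: zero)
  next
    case (Cons x xs)
    have "Poly_Mapping.single (Word (x # xs)) 1 = fa_var x * Poly_Mapping.single (Word xs) 1"
      by (simp add: fa_var_def mult_single plus_free_monoid_def)
    then have "Poly_Mapping.single (Word (x # xs)) 1 * eh_poly G - eh_poly (foldr rho (x # xs) G)
      = fa_var x * (Poly_Mapping.single (Word xs) 1 * eh_poly G - eh_poly (foldr rho xs G))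
        + (fa_var x * eh_poly (foldr rho xs G) - eh_poly (rho x (foldr rho xs G)))"
      by (simp add: algebra_simps)
    also have "\<dots> \<in> J" by (intro add left Cons.IH eh_poly_var)
    finally show ?case .
  qed
  have "Poly_Mapping.single w k = fa_const k * Poly_Mapping.single (Word (letters w)) 1"
    by (simp add: fa_const_single)
  then have "(u + Poly_Mapping.single w k) * eh_poly G - eh_poly (act (u + Poly_Mapping.single w k) G)
    = (u * eh_poly G - eh_poly (act u G))
     + fa_const k * (Poly_Mapping.single (Word (letters w)) 1 * eh_poly G - eh_poly (foldr rho (letters w) G))"
    by (simp add: act_add act_mult act_single eh_poly_simps algebra_simps)
  also have "\<dots> \<in> J" by (intro add left 2 word)
  finally show ?case .
qed

text \<open>The ordered polynomial congruent to \<open>u\<close> is read off from the vector \<open>u 1\<close> of the model. This is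
  what makes the homomorphism from the quotient by \<open>W\<close> to the model injective.\<close>

lemma normal_form: "u - eh_poly (act u 1) \<in> J"
proof -
  have "eh_poly 1 = 1"
    by (simp add: one_pCons eh_poly_simps h_poly_simps fa_const_one)
  then show ?thesis using eh_poly_act[of u 1] by simp
qed

lemma annihilator_subset:
  assumes "act u 1 = 0"
  shows "u \<in> J"
  using normal_form[of u] assms by (simp add: eh_poly_simps)

end

section \<open>The universal quasi-Whittaker module\<close>

lemma smult_const_sum: "(\<Sum>i\<in>A. smult [:f i:] G) = smult [:\<Sum>i\<in>A. f i:] G" for G :: model
  by (induction A rule: infinite_finite_induct) (simp_all add: const_poly_add)

text \<open>All computations take place with representatives in the free algebra, where ring arithmetic
  is that of a type class.\<close>

definition cls :: "schrodinger free_alg \<Rightarrow> schrodinger free_alg set" where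
  "cls u = uea_ideal UNIV +>\<^bsub>free_algebra UNIV\<^esub> u"

lemma all_free: "u \<in> carrier (free_algebra UNIV)" for u :: "schrodinger free_alg"
  by (simp add: carrier_free_algebra)

lemma cls_ops:
  "cls u \<otimes>\<^bsub>uea UNIV\<^esub> cls v = cls (u * v)" "cls u \<oplus>\<^bsub>uea UNIV\<^esub> cls v = cls (u + v)"
  "\<one>\<^bsub>uea UNIV\<^esub> = cls 1"
  unfolding cls_def using uea_coset_ops[OF UNIV_lie_subalgebra all_free all_free] by blast+

lemma cls_closed [simp]: "cls u \<in> carrier (uea UNIV)"
  unfolding cls_def by (auto simp: uea_def FactRing_def A_RCOSETS_def RCOSETS_def a_r_coset_def all_free)

lemma cls_cases:
  assumes "X \<in> carrier (uea UNIV)"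
  obtains u where "X = cls u"
  using uea_carrierE[OF assms] unfolding cls_def by metis

lemma cls_eq_iff: "cls u = cls v \<longleftrightarrow> u - v \<in> uea_ideal UNIV"
proof -
  interpret I: ideal "uea_ideal UNIV" "free_algebra UNIV" by (rule uea_ideal[OF UNIV_lie_subalgebra])
  have mem: "u \<in> cls v \<longleftrightarrow> u - v \<in> uea_ideal UNIV" for u v
    by (force simp: cls_def a_r_coset_def r_coset_def free_algebra_simps)
  have "u - u \<in> uea_ideal UNIV" using uea_ideal_zero by simp
  with mem[of u u] have "u \<in> cls u" by blast
  moreover have "cls u = cls v" if "u \<in> cls v"
    using I.a_repr_independence'[OF _ all_free] that unfolding cls_def by metis
  ultimately show ?thesis using mem by blast
qed

lemma cls_diff: "cls u \<ominus>\<^bsub>uea UNIV\<^esub> cls v = cls (u - v)"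
proof -
  interpret ring "uea UNIV :: schrodinger free_alg set ring" by (rule uea_ring[OF UNIV_lie_subalgebra])
  have "cls (u - v) \<oplus>\<^bsub>uea UNIV\<^esub> cls v = cls u" by (simp add: cls_ops)
  then show ?thesis
    by (metis cls_closed minus_eq a_assoc r_neg r_zero a_inv_closed)
qed

lemma fa_eval_const: "fa_eval \<phi> (fa_const k) = k"
  and fa_eval_var: "fa_eval \<phi> (fa_var x) = \<phi> x"
  by (simp_all add: fa_const_def fa_var_def fa_eval_single zero_free_monoid_def)

locale quasi_whittaker_type =
  fixes \<phi> :: "schrodinger \<Rightarrow> complex"
  assumes char: "lie_character heisenberg \<phi>"

sublocale quasi_whittaker_type \<subseteq> tensor_product "uea UNIV" "uea heisenberg" "uea_map UNIV" "character_module \<phi>"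
proof (rule tensor_product.intro)
  show "ring (uea UNIV :: schrodinger free_alg set ring)" by (rule uea_ring[OF UNIV_lie_subalgebra])
  show "left_module (uea heisenberg) (character_module \<phi>)" by (rule character_left_module[OF char])
  show "tensor_product_axioms (uea UNIV) (uea heisenberg) (uea_map UNIV)"
  proof
    fix X assume "X \<in> carrier (uea heisenberg)"
    then obtain a where "a \<in> carrier (free_algebra heisenberg)" "X = uea_ideal heisenberg +>\<^bsub>free_algebra heisenberg\<^esub> a"
      by (rule uea_carrierE)
    then show "uea_map UNIV X \<in> carrier (uea UNIV)"
      using uea_map_coset[OF heisenberg_lie_subalgebra] cls_closed[of a] by (simp add: cls_def)
  qed
qed

context quasi_whittaker_type
begin

abbreviation "M \<equiv> quasi_whittaker \<phi>"

lemma M_eq_T: "M = T"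
  by (simp add: quasi_whittaker_def)

text \<open>The element \<open>u w\<close> of the universal module.\<close>

definition vec_of :: "schrodinger free_alg \<Rightarrow> quasi_whittaker_elem" where
  "vec_of u = K #>\<^bsub>F\<^esub> frag_of (cls u, 1)"

lemma S_mem: "(cls u, n) \<in> S"
  by (simp add: character_module_def)

lemma M_left_module: "left_module (uea UNIV) M"
  unfolding M_eq_T by (rule tensor_left_module)

lemma gen_eq: "quasi_whittaker_gen \<phi> = vec_of 1"
  by (simp add: quasi_whittaker_gen_def pure_tensor_def vec_of_def cls_ops)

lemma smult_vec_of: "cls v \<odot>\<^bsub>M\<^esub> vec_of u = vec_of (v * u)"
  unfolding M_eq_T vec_of_def
  by (subst tensor_smult) (simp_all add: keys_frag_of S_mem cls_ops del: mem_Sigma_iff)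

text \<open>Elements of the Heisenberg subalgebra act on \<open>w\<close> by \<open>\<phi>\<close>, through the balancing relations.\<close>

lemma balanced_vec_of:
  assumes "a \<in> carrier (free_algebra heisenberg)"
  shows "frag_of (cls (u * a), n) - frag_of (cls u, fa_eval \<phi> a * n) \<in> K"
proof -
  let ?X = "uea_ideal heisenberg +>\<^bsub>free_algebra heisenberg\<^esub> a"
  have X: "?X \<in> carrier (uea heisenberg)"
    using assms by (auto simp: uea_def FactRing_def A_RCOSETS_def RCOSETS_def a_r_coset_def)
  have "frag_of (cls u \<otimes>\<^bsub>uea UNIV\<^esub> uea_map UNIV ?X, n) - frag_of (cls u, ?X \<odot>\<^bsub>character_module \<phi>\<^esub> n) \<in> K"
    by (rule kernel_balanced[OF _ X]) (simp_all add: character_module_def)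
  then show ?thesis
    using assms by (simp add: uea_map_coset[OF heisenberg_lie_subalgebra] character_module_def
      fa_eval_coset[OF heisenberg_lie_subalgebra char] cls_ops flip: cls_def)
qed

lemma add_kernel: "frag_of (cls (u + v), n) - (frag_of (cls u, n) + frag_of (cls v, n)) \<in> K"
  using kernel_add_left[of "cls u" "cls v" n] by (simp add: cls_ops character_module_def)

lemma vec_of_add: "vec_of (u + v) = vec_of u \<oplus>\<^bsub>M\<^esub> vec_of v"
proof -
  have keys: "Poly_Mapping.keys (frag_of (cls u, 1)) \<subseteq> S" for u
    by (simp add: keys_frag_of S_mem del: mem_Sigma_iff)
  have "Poly_Mapping.keys (frag_of (cls u, 1) + frag_of (cls v, 1)) \<subseteq> S"
    using keys_add[of "frag_of (cls u, 1)" "frag_of (cls v, 1)"] keys[of u] keys[of v] by blast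
  then show ?thesis
    unfolding M_eq_T vec_of_def tensor_add[OF keys keys] by (rule coset_eqI) (rule add_kernel)
qed

lemma vec_of_balanced:
  assumes "a \<in> carrier (free_algebra heisenberg)" "a' \<in> carrier (free_algebra heisenberg)" "fa_eval \<phi> a = fa_eval \<phi> a'"
  shows "vec_of a = vec_of a'"
proof -
  have "frag_of (cls a, 1) - frag_of (cls a', 1) \<in> K"
    using kernel_closed(3)[OF balanced_vec_of[OF assms(1), of 1 1] balanced_vec_of[OF assms(2), of 1 1]] assms(3) by simp
  then show ?thesis unfolding vec_of_def
    by (intro coset_eqI) (simp_all add: keys_frag_of S_mem del: mem_Sigma_iff)
qed

lemma vec_of_cong: "u - v \<in> uea_ideal UNIV \<Longrightarrow> vec_of u = vec_of v"
  using cls_eq_iff[of u v] by (simp add: vec_of_def)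

text \<open>The scalar \<open>n\<close> in a pure tensor is the value of \<open>\<phi>\<close> at the constant \<open>n\<close> of the enveloping
  algebra of the Heisenberg subalgebra, so it can be moved across.\<close>

lemma vec_of_surj:
  assumes "X \<in> carrier M"
  obtains u where "X = vec_of u"
proof -
  obtain x where x: "Poly_Mapping.keys x \<subseteq> S" "X = K #>\<^bsub>F\<^esub> x"
    using assms by (auto simp: M_eq_T tensor_module_def Let_def RCOSETS_def)
  from x(1) have "\<exists>u. x - frag_of (cls u, 1) \<in> K"
  proof (induction x rule: frag_induction)
    case zero
    have "frag_of (cls 0, 1) \<in> K" using add_kernel[of 0 0 1] kernel_closed(3)[OF kernel_closed(1)] by fastforce
    then show ?case using kernel_closed(3)[OF kernel_closed(1)] by (auto intro!: exI[of _ 0])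
  next
    case (one p)
    then obtain u n where p: "p = (cls u, n)" by (auto elim: cls_cases)
    have "frag_of (cls (u * fa_const n), 1) - frag_of (cls u, n) \<in> K"
      using balanced_vec_of[of "fa_const n" u 1] by (simp add: fa_const_closed fa_eval_const)
    from kernel_closed(3)[OF kernel_closed(1) this] show ?case unfolding p by auto
  next
    case (diff x y)
    then obtain u v where u: "x - frag_of (cls u, 1) \<in> K" and v: "y - frag_of (cls v, 1) \<in> K" by blast
    have "(x - frag_of (cls u, 1)) - (y - frag_of (cls v, 1)) + (frag_of (cls (u - v + v), 1) - (frag_of (cls (u - v), 1) + frag_of (cls v, 1))) \<in> K"
      by (rule kernel_closed(2)[OF kernel_closed(3)[OF u v] add_kernel])
    then have "(x - y) - frag_of (cls (u - v), 1) \<in> K" by (simp add: algebra_simps)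
    then show ?case by blast
  qed
  then obtain u where "x - frag_of (cls u, 1) \<in> K" by blast
  then have "X = vec_of u" unfolding x(2) vec_of_def
    by (intro coset_eqI) (simp_all add: keys_frag_of S_mem del: mem_Sigma_iff)
  then show ?thesis by (rule that)
qed

lemma vec_of_closed [simp]: "vec_of u \<in> carrier M"
  unfolding M_eq_T vec_of_def tensor_module_def Let_def RCOSETS_def
  by (auto simp: keys_frag_of S_mem simp del: mem_Sigma_iff)

lemma vec_of_zero: "vec_of 0 = \<zero>\<^bsub>M\<^esub>"
proof -
  interpret left_module "uea UNIV" M by (rule M_left_module)
  show ?thesis using vec_of_add[of 0 0] M.add.l_cancel_one by (metis add_0 vec_of_closed)
qed

lemma vec_of_diff: "vec_of (u - v) = vec_of u \<ominus>\<^bsub>M\<^esub> vec_of v"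
proof -
  interpret left_module "uea UNIV" M by (rule M_left_module)
  show ?thesis using vec_of_add[of "u - v" v]
    by (metis M.minus_eq diff_add_cancel vec_of_closed M.a_assoc M.r_neg M.r_zero M.a_inv_closed)
qed

lemma vec_of_zeroD:
  assumes "vec_of u = \<zero>\<^bsub>M\<^esub>"
  shows "frag_of (cls u, 1) \<in> K"
proof -
  have "frag_of (cls u, 1) \<in> K #>\<^bsub>F\<^esub> frag_of (cls u, 1)"
    by (rule group.rcos_self[OF group_free_Abelian_group _ kernel_subgroup])
       (simp add: keys_frag_of S_mem del: mem_Sigma_iff)
  with assms show ?thesis by (simp add: vec_of_def M_eq_T tensor_module_def Let_def)
qed

end

section \<open>Maximality\<close>

lemma heisenberg_mem: "sch_p \<in> heisenberg" "sch_q \<in> heisenberg" "sch_z \<in> heisenberg"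
  "k *s sch_p + l *s sch_q \<in> heisenberg" "l *s sch_q - k *s sch_p \<in> heisenberg"
  unfolding heisenberg_def by (intro vec.span_base vec.span_add vec.span_diff vec.span_scale; simp)+

lemma heisenberg_coords:
  assumes "x \<in> heisenberg"
  shows "x $ BE = 0" "x $ BH = 0" "x $ BF = 0"
    and "x = x $ BP *s sch_p + x $ BQ *s sch_q + x $ BZ *s sch_z"
proof -
  have sub: "vec.subspace {v :: schrodinger. v $ BE = 0 \<and> v $ BH = 0 \<and> v $ BF = 0}"
    by (auto simp: vec.subspace_def)
  have "heisenberg \<subseteq> {v. v $ BE = 0 \<and> v $ BH = 0 \<and> v $ BF = 0}"
    unfolding heisenberg_def
    by (rule vec.span_minimal[OF _ sub]) (auto simp: sch_basis_defs axis_def)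
  with assms show "x $ BE = 0" "x $ BH = 0" "x $ BF = 0" by auto
  then show "x = x $ BP *s sch_p + x $ BQ *s sch_q + x $ BZ *s sch_z"
    by (simp add: vec_eq_iff all_sbasis sch_basis_defs axis_def)
qed

context quasi_whittaker_type
begin

lemma phi_linear:
  "\<phi> (k *s sch_p + l *s sch_q) = k * \<phi> sch_p + l * \<phi> sch_q"
  "\<phi> (l *s sch_q - k *s sch_p) = l * \<phi> sch_q - k * \<phi> sch_p"
  "\<phi> sch_z = 0"
proof -
  have add: "\<phi> (x + y) = \<phi> x + \<phi> y" if "x \<in> heisenberg" "y \<in> heisenberg" for x y
    using char that by (auto simp: lie_character_def)
  have scale: "\<phi> (k *s x) = k * \<phi> x" if "x \<in> heisenberg" for k x
    using char that by (auto simp: lie_character_def)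
  have mem: "k *s x \<in> heisenberg" if "x \<in> heisenberg" for k x
    using that unfolding heisenberg_def by (rule vec.span_scale)
  show *: "\<phi> (k *s sch_p + l *s sch_q) = k * \<phi> sch_p + l * \<phi> sch_q" for k l
    by (simp add: add scale mem heisenberg_mem)
  have "l *s sch_q - k *s sch_p = (- k) *s sch_p + l *s sch_q" by (simp add: algebra_simps)
  then show "\<phi> (l *s sch_q - k *s sch_p) = l * \<phi> sch_q - k * \<phi> sch_p"
    using *[of "- k" l] by simp
  show "\<phi> sch_z = 0"
    using char heisenberg_mem sch_bracket_table(6) by (metis lie_character_def)
qed

lemma phi_coords:
  assumes "x \<in> heisenberg"
  shows "\<phi> x = x $ BP * \<phi> sch_p + x $ BQ * \<phi> sch_q"
proof -
  have add: "\<phi> (x + y) = \<phi> x + \<phi> y" if "x \<in> heisenberg" "y \<in> heisenberg" for x y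
    using char that by (auto simp: lie_character_def)
  have "\<phi> (x $ BZ *s sch_z) = 0"
    using char heisenberg_mem(3) phi_linear(3) by (auto simp: lie_character_def)
  moreover have "x $ BZ *s sch_z \<in> heisenberg"
    using heisenberg_mem(3) unfolding heisenberg_def by (rule vec.span_scale)
  ultimately have "\<phi> (x $ BP *s sch_p + x $ BQ *s sch_q + x $ BZ *s sch_z) = x $ BP * \<phi> sch_p + x $ BQ * \<phi> sch_q"
    by (simp add: add heisenberg_mem phi_linear)
  then show ?thesis using heisenberg_coords(4)[OF assms] by simp
qed

end

locale quasi_whittaker_model = quasi_whittaker_type \<phi> + twisted_model a b c d \<xi>
  for \<phi> a b c d \<xi> +
  assumes a: "a = \<phi> sch_p" and b: "b = \<phi> sch_q"
begin

lemma rho_heisenberg: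
  assumes "x \<in> heisenberg"
  shows "rho x 1 = smult [:\<phi> x:] 1"
proof -
  have "map_poly (shift (-1)) 1 = (1 :: model)"
    by (simp add: one_pCons map_poly_pCons)
  then show ?thesis
    using phi_coords[OF assms] heisenberg_coords(1-3)[OF assms]
    by (simp add: rho_def wh_rep_def UNIV_sbasis twist_nth algebra_simps flip: a b)
qed

lemma act_heisenberg:
  assumes "v \<in> carrier (free_algebra heisenberg)"
  shows "act v 1 = smult [:fa_eval \<phi> v:] 1"
proof -
  have word: "foldr rho xs 1 = smult [:prod_list (map \<phi> xs):] 1" if "set xs \<subseteq> heisenberg" for xs
    using that
  proof (induction xs)
    case (Cons x xs)
    then have "foldr rho (x # xs) 1 = smult [:prod_list (map \<phi> xs):] (smult [:\<phi> x:] 1)"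
      by (simp only: foldr.simps o_apply list.set insert_subset rho_smult rho_heisenberg)
    then show ?case by (simp add: mult.commute)
  qed (simp add: const_poly)
  have "act v 1 = (\<Sum>w\<in>Poly_Mapping.keys v. smult [:Poly_Mapping.lookup v w * prod_list (map \<phi> (letters w)):] 1)"
    unfolding act_def using assms by (intro sum.cong) (auto simp: carrier_free_algebra word)
  then show ?thesis by (simp only: smult_const_sum fa_eval_def)
qed

text \<open>The homomorphism to the model is well defined: the pairing of \<open>u\<close> and \<open>n\<close> to \<open>n (u 1)\<close> is
  balanced because the Heisenberg subalgebra acts on \<open>1\<close> by \<open>\<phi>\<close>.\<close>

lemma act_vec_of_zero:
  assumes "vec_of u = \<zero>\<^bsub>M\<^esub>"
  shows "act u 1 = 0"
proof -
  define rep where "rep X = (SOME u. cls u = X)" for X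
  define f where "f = (\<lambda>(X, n). smult [:n:] (act (rep X) 1))"
  \<comment> \<open>The action of the free algebra is constant on classes, so the choice of representative is immaterial.\<close>
  have f: "f (cls u, n) = smult [:n:] (act u 1)" for u n
  proof -
    have "cls (rep (cls u)) = cls u" unfolding rep_def by (rule someI) simp
    then have "act (rep (cls u) - u) 1 = 0" using act_ideal cls_eq_iff by blast
    then show ?thesis by (simp add: f_def act_minus)
  qed
  have "frag_sum f (frag_of (cls u, 1)) = 0"
  proof (rule frag_sum_kernel[OF _ _ _ vec_of_zeroD[OF assms]])
    fix X Y n assume "X \<in> carrier (uea UNIV)" "Y \<in> carrier (uea UNIV)"
    then show "f (X \<oplus>\<^bsub>uea UNIV\<^esub> Y, n) = f (X, n) + f (Y, n)"
      by (auto elim!: cls_cases simp: cls_ops f act_add smult_add_right)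
  next
    fix X m n assume "X \<in> carrier (uea UNIV)"
    then show "f (X, m \<oplus>\<^bsub>character_module \<phi>\<^esub> n) = f (X, m) + f (X, n)"
      by (auto elim!: cls_cases simp: f const_poly_add character_module_def)
  next
    fix X A n assume X: "X \<in> carrier (uea UNIV)" and A: "A \<in> carrier (uea heisenberg)"
    obtain u where "X = cls u" by (rule cls_cases[OF X])
    moreover obtain v where "v \<in> carrier (free_algebra heisenberg)"
      "A = uea_ideal heisenberg +>\<^bsub>free_algebra heisenberg\<^esub> v"
      by (rule uea_carrierE[OF A])
    moreover have "act (u * v) 1 = smult [:fa_eval \<phi> v:] (act u 1)"
      if "v \<in> carrier (free_algebra heisenberg)" for u v
      by (simp only: act_mult act_heisenberg[OF that] act_smult)
    ultimately show "f (X \<otimes>\<^bsub>uea UNIV\<^esub> uea_map UNIV A, n) = f (X, A \<odot>\<^bsub>character_module \<phi>\<^esub> n)"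
      by (simp add: uea_map_coset[OF heisenberg_lie_subalgebra] character_module_def
          fa_eval_coset[OF heisenberg_lie_subalgebra char] cls_ops f mult.commute
          flip: cls_def)
  qed
  then show ?thesis by (simp add: f const_poly)
qed

abbreviation "W \<equiv> quasi_W \<phi> \<xi>"

lemma gen_BF: "gen BF = fa_var ((\<phi> sch_p)\<^sup>2 *s sch_f - (\<phi> sch_q)\<^sup>2 *s sch_e - (\<phi> sch_p * \<phi> sch_q) *s sch_h)"
  by (simp add: gen_def twist_def axis_def flip: a b)

lemma W_eq: "W = {vec_of (r * (gen BF - fa_const \<xi>)) |r. True}"
proof -
  have "quasi_C \<phi> = cls (gen BF)" by (simp add: quasi_C_def uea_incl_def cls_def gen_BF)
  moreover have "uea_scalar UNIV \<xi> = cls (fa_const \<xi>)" by (simp add: uea_scalar_def cls_def)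
  ultimately have "W = {X \<odot>\<^bsub>M\<^esub> vec_of (gen BF - fa_const \<xi>) |X. X \<in> carrier (uea UNIV)}"
    by (simp add: quasi_W_def cyclic_submodule_def gen_eq cls_diff smult_vec_of)
  also have "\<dots> = {vec_of (r * (gen BF - fa_const \<xi>)) |r. True}"
    by (auto elim!: cls_cases simp: smult_vec_of) (metis cls_closed smult_vec_of)
  finally show ?thesis .
qed

lemma W_submodule: "submodule W (uea UNIV) M"
proof (rule left_module_submoduleI[OF M_left_module])
  fix x y assume "x \<in> W" "y \<in> W"
  then obtain r s where "x = vec_of (r * (gen BF - fa_const \<xi>))" "y = vec_of (s * (gen BF - fa_const \<xi>))"
    by (auto simp: W_eq)
  then have "x \<oplus>\<^bsub>M\<^esub> y = vec_of ((r + s) * (gen BF - fa_const \<xi>))"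
    by (simp add: distrib_right vec_of_add)
  then show "x \<oplus>\<^bsub>M\<^esub> y \<in> W" by (auto simp: W_eq)
next
  fix X x assume "X \<in> carrier (uea UNIV)" "x \<in> W"
  then obtain u r where "X = cls u" "x = vec_of (r * (gen BF - fa_const \<xi>))"
    by (auto simp: W_eq elim!: cls_cases)
  then have "X \<odot>\<^bsub>M\<^esub> x = vec_of ((u * r) * (gen BF - fa_const \<xi>))"
    by (simp add: smult_vec_of mult.assoc)
  then show "X \<odot>\<^bsub>M\<^esub> x \<in> W" by (auto simp: W_eq)
qed (auto simp: W_eq)

text \<open>The kernel of the homomorphism to the model is \<open>W\<close>. One inclusion says that \<open>C - \<xi>\<close> kills
  the vector \<open>1\<close>. For the other, the elements that send \<open>w\<close> into \<open>W\<close> form an instance of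
  \<open>whittaker_ideal\<close>, so normal forms apply.\<close>

lemma vec_of_mem_W_iff: "vec_of u \<in> W \<longleftrightarrow> act u 1 = 0"
proof
  assume "vec_of u \<in> W"
  then obtain r where r: "vec_of u = vec_of (r * (gen BF - fa_const \<xi>))" by (auto simp: W_eq)
  interpret left_module "uea UNIV" M by (rule M_left_module)
  have "vec_of (u - r * (gen BF - fa_const \<xi>)) = \<zero>\<^bsub>M\<^esub>"
    using r by (simp add: vec_of_diff M.minus_eq M.r_neg)
  then have "act (u - r * (gen BF - fa_const \<xi>)) 1 = 0" by (rule act_vec_of_zero)
  moreover have "wh_op \<xi> BF 1 = smult [:\<xi>:] 1"
    by (simp add: one_pCons map_poly_pCons)
  ultimately show "act u 1 = 0" by (simp add: act_minus act_mult act_gen del: wh_op.simps)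
next
  assume u: "act u 1 = 0"
  interpret W: submodule W "uea UNIV" M by (rule W_submodule)
  have zeroW: "vec_of 0 \<in> W" using W.one_closed by (simp add: vec_of_zero)
  have heis: "vec_of (fa_var x - fa_const (\<phi> x)) \<in> W" if "x \<in> heisenberg" for x
  proof -
    interpret left_module "uea UNIV" M by (rule M_left_module)
    have "vec_of (fa_var x) = vec_of (fa_const (\<phi> x))"
      using that by (intro vec_of_balanced) (simp_all add: fa_var_closed fa_const_closed fa_eval_const fa_eval_var)
    then have "vec_of (fa_var x - fa_const (\<phi> x)) = \<zero>\<^bsub>M\<^esub>"
      by (simp add: vec_of_diff M.minus_eq M.r_neg)
    then show ?thesis using zeroW by (simp add: vec_of_zero)
  qed
  interpret J: whittaker_ideal a b c d \<xi> "{u. vec_of u \<in> W}"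
  proof
    show "u - v \<in> {u. vec_of u \<in> W}" if uv: "u \<in> {u. vec_of u \<in> W}" "v \<in> {u. vec_of u \<in> W}" for u v
    proof -
      obtain r s where "vec_of u = vec_of (r * (gen BF - fa_const \<xi>))" "vec_of v = vec_of (s * (gen BF - fa_const \<xi>))"
        using uv by (auto simp: W_eq)
      then have "vec_of (u - v) = vec_of ((r - s) * (gen BF - fa_const \<xi>))"
        by (simp add: left_diff_distrib vec_of_diff)
      then show ?thesis by (auto simp: W_eq)
    qed
    show "v * u \<in> {u. vec_of u \<in> W}" if "u \<in> {u. vec_of u \<in> W}" for u v
      using W.smult_closed[of "cls v" "vec_of u"] that by (simp add: smult_vec_of)
    show "uea_ideal UNIV \<subseteq> {u. vec_of u \<in> W}"
      using vec_of_cong[of _ 0] zeroW by auto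
    have "gen BP = fa_var (c *s sch_p + d *s sch_q)" "gen BQ = fa_var (a *s sch_q - b *s sch_p)"
      "gen BZ = fa_var sch_z"
      by (simp_all add: gen_def twist_def axis_def)
    then show "gen BP - 1 \<in> {u. vec_of u \<in> W}" "gen BQ \<in> {u. vec_of u \<in> W}" "gen BZ \<in> {u. vec_of u \<in> W}"
      using heis[OF heisenberg_mem(4)[of c d]] heis[OF heisenberg_mem(5)[of a b]] heis[OF heisenberg_mem(3)] det
      by (simp_all add: phi_linear fa_const_one mult.commute flip: a b)
    show "gen BF - fa_const \<xi> \<in> {u. vec_of u \<in> W}"
      by (auto simp: W_eq intro!: exI[of _ 1])
  qed
  show "vec_of u \<in> W" using J.annihilator_subset[OF u] by simp
qed

text \<open>Transitivity of the action on the model gives \<open>v\<close> with \<open>v u 1 = 1\<close> for any \<open>u w\<close> outside \<open>W\<close>,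
  and then \<open>w - v u w\<close> lies in \<open>W\<close>.\<close>

lemma W_maximal: "maximal_submodule W (uea UNIV) M"
  unfolding maximal_submodule_def
proof (intro conjI allI impI)
  show "left_module (uea UNIV) M" by (rule M_left_module)
  show "submodule W (uea UNIV) M" by (rule W_submodule)
  have "vec_of 1 \<notin> W" by (simp add: vec_of_mem_W_iff)
  then show "W \<noteq> carrier M" using vec_of_closed by metis
next
  fix N' assume "submodule N' (uea UNIV) M \<and> W \<subseteq> N'"
  then have N': "submodule N' (uea UNIV) M" and sub: "W \<subseteq> N'" by auto
  interpret N': submodule N' "uea UNIV" M by (rule N')
  interpret left_module "uea UNIV" M by (rule M_left_module)
  have N'_sub: "N' \<subseteq> carrier M" using N'.subset by simp
  show "N' = W \<or> N' = carrier M"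
  proof (cases "N' = W")
    case False
    with sub obtain x where x: "x \<in> N'" "x \<notin> W" by blast
    with N'_sub obtain u where u: "x = vec_of u" using vec_of_surj by blast
    with x have "act u 1 \<noteq> 0" by (simp add: vec_of_mem_W_iff)
    then obtain v where v: "act v (act u 1) = 1" using act_transitive by blast
    then have "act (1 - v * u) 1 = 0" by (simp add: act_minus act_mult)
    then have "vec_of (1 - v * u) \<in> N'" using sub by (auto simp: vec_of_mem_W_iff)
    moreover have "vec_of (v * u) \<in> N'"
      using N'.smult_closed[of "cls v" x] x u by (simp add: smult_vec_of)
    ultimately have "vec_of (1 - v * u) \<oplus>\<^bsub>M\<^esub> vec_of (v * u) \<in> N'" using N'.m_closed by simp
    then have one: "vec_of 1 \<in> N'" by (simp flip: vec_of_add)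
    have "y \<in> N'" if y: "y \<in> carrier M" for y
    proof -
      obtain w where "y = vec_of w" using vec_of_surj[OF y] by blast
      then show ?thesis using N'.smult_closed[of "cls w" "vec_of 1"] one by (simp add: smult_vec_of)
    qed
    with N'_sub show ?thesis by blast
  qed simp
qed

end

theorem proposition4p2:
  fixes \<phi> :: "schrodinger \<Rightarrow> complex" and \<xi> :: complex
  assumes "lie_character heisenberg \<phi>"
    and "\<exists>x\<in>heisenberg. \<phi> x \<noteq> 0"
  shows "maximal_submodule (quasi_W \<phi> \<xi>) (uea UNIV) (quasi_whittaker \<phi>) \<and>
         simple_module (uea UNIV) (quasi_L \<phi> \<xi>)"
proof -
  interpret quasi_whittaker_type \<phi> by standard (rule assms(1))
  have "\<phi> sch_p \<noteq> 0 \<or> \<phi> sch_q \<noteq> 0" using assms(2) phi_coords by force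
  then obtain c d where det: "\<phi> sch_p * c + \<phi> sch_q * d = 1"
  proof
    assume "\<phi> sch_p \<noteq> 0"
    then show ?thesis using that[of "1 / \<phi> sch_p" 0] by simp
  next
    assume "\<phi> sch_q \<noteq> 0"
    then show ?thesis using that[of 0 "1 / \<phi> sch_q"] by simp
  qed
  interpret quasi_whittaker_model \<phi> "\<phi> sch_p" "\<phi> sch_q" c d \<xi>
    by unfold_locales (simp_all add: det)
  show ?thesis
    using W_maximal maximal_submodule_simple_quotient[OF W_maximal] by (simp add: quasi_L_def)
qed

end
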